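(* Let $w=\varepsilon_1\ldots\varepsilon_k$ be a non-empty admissible binary word. For all integers $m\ge0$, $n\ge0$ and $N\ge1$, $$\zeta(w)_{m,n}=\sum_{s\in S}\zeta_{]m,m+N]}(\mathbf b_s)\,\zeta_{]n,n+N]}(\mathbf a_s)\,\zeta(w_s)_{m+N,n+N}+\sum_{M=1}^{N}\binom{m+n+2M}{m+M}^{-1}\sum_{i=1}^{k-1}\varphi_{m,m+M}(\mathbf b_i)\,\varphi_{n,n+M}(\mathbf a_i)\,\lambda_{m+M,n+M}(\varepsilon_i,\varepsilon_{i+1}).$$
   Context: A binary word is a finite word over $\{0,1\}$; it is admissible if empty or it starts with $0$ and ends with $1$. A composition is a finite sequence of positive integers; its binary word is $\mathbf w(a_1,\ldots,a_r)=\{0\}_{a_1-1}1\cdots\{0\}_{a_r-1}1$ ($\{0\}_u$ = $u$ letters $0$), a bijection onto binary words that are empty or end with $1$. $\overline0=1,\overline1=0$. Set $f_0(t)=1/t$, $f_1(t)=1/(1-t)$. For a non-empty admissible binary word $u=\eta_1\ldots\eta_\ell$ and integers $p,q\ge0$, $\zeta(u)_{p,q}=\int_{1>t_1>\cdots>t_\ell>0}(1-t_1)^p f_{\eta_1}(t_1)\cdots f_{\eta_\ell}(t_\ell)t_\ell^q\,dt_1\cdots dt_\ell$. For a non-empty composition $\mathbf c=(c_1,\ldots,c_r)$ and integers $0\le p<q$: $\varphi_{p,q}(\mathbf c)=q^{-c_1}\sum_{q>n_2>\cdots>n_r>p}n_2^{-c_2}\cdots n_r^{-c_r}$ (equal to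 $q^{-c_1}$ if $r=1$). For any composition $\mathbf c$ and $0\le p\le q$: $\zeta_{]p,q]}(\mathbf c)=\sum_{q\ge n_1>\cdots>n_r>p}n_1^{-c_1}\cdots n_r^{-c_r}$ (equal to $1$ if $\mathbf c$ is empty). For a pair $s=(i,j)$ with $0\le i\le j\le k$: $w_s=\varepsilon_{i+1}\ldots\varepsilon_j$; $\mathbf a_s$ is the composition with binary word $\varepsilon_{j+1}\ldots\varepsilon_k$; $\mathbf b_s$ the composition with binary word $\overline{\varepsilon_i}\ldots\overline{\varepsilon_1}$. $S$ is the set of such pairs with $w_s$ non-empty, starting with $0$ and ending with $1$. For $1\le i\le k-1$, $\mathbf a_i=\mathbf a_{(i,i)}$ and $\mathbf b_i=\mathbf b_{(i,i)}$. For bits $\varepsilon,\varepsilon'$ and positive integers $p,q$: $\lambda_{p,q}(\varepsilon,\varepsilon')=1+\delta+\delta'$ where $\delta=p/q$ if $\varepsilon=0$ and $\delta=0$ if $\varepsilon=1$, and $\delta'=q/p$ if $\varepsilon'=1$ and $\delta'=0$ if $\varepsilon'=0$. *)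

theory Defs
  imports "HOL-Analysis.Analysis"
begin

text \<open>Binary words are lists of booleans; the letter 0 is \<open>False\<close>, the letter 1 is \<open>True\<close>,
  and the involution exchanging the two letters is \<open>Not\<close>.\<close>

type_synonym word = "bool list"

definition admissible :: "word \<Rightarrow> bool" where
  "admissible u \<longleftrightarrow> u = [] \<or> (hd u = False \<and> last u = True)"

definition composition :: "nat list \<Rightarrow> bool" where
  "composition c \<longleftrightarrow> (\<forall>a\<in>set c. a > 0)"

definition comp_word :: "nat list \<Rightarrow> word" where
  "comp_word c = concat (map (\<lambda>a. replicate (a - 1) False @ [True]) c)"

text \<open>Meaningful only for words that are empty or end with 1; see \<open>bij_betw_comp_word\<close> below.\<close>

definition word_comp :: "word \<Rightarrow> nat list" where
  "word_comp u = (THE c. composition c \<and> comp_word c = u)"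

lemma comp_word_inj:
  "composition c \<Longrightarrow> composition d \<Longrightarrow> comp_word c = comp_word d \<Longrightarrow> c = d"
proof (induction c arbitrary: d)
  case Nil
  then show ?case by (cases d) (auto simp: comp_word_def)
next
  case (Cons a c)
  then obtain b d' where d: "d = b # d'"
    by (cases d) (auto simp: comp_word_def)
  have eq: "replicate (a - 1) False @ True # comp_word c
      = replicate (b - 1) False @ True # comp_word d'"
    using Cons.prems(3) by (simp add: d comp_word_def)
  have *: "takeWhile Not (replicate n False @ True # xs) = replicate n False" for n xs
    by (induction n) auto
  have "replicate (a - 1) False = replicate (b - 1) False"
    using arg_cong[OF eq, of "takeWhile Not"] by (simp only: *)
  then have "a - 1 = b - 1" by (metis length_replicate)
  moreover from this have "comp_word c = comp_word d'" using eq by simp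
  ultimately show ?case
    using Cons.IH[of d'] Cons.prems(1,2) by (auto simp: d composition_def)
qed

lemma comp_word_surj:
  "u = [] \<or> last u = True \<Longrightarrow> \<exists>c. composition c \<and> comp_word c = u"
proof (induction u)
  case Nil
  show ?case by (rule exI[of _ "[]"]) (simp add: composition_def comp_word_def)
next
  case (Cons x u)
  show ?case
  proof (cases x)
    case True
    obtain c where "composition c" "comp_word c = u"
      using Cons by (cases u) auto
    with True show ?thesis
      by (intro exI[of _ "1 # c"]) (simp add: composition_def comp_word_def)
  next
    case False
    with Cons.prems have "u \<noteq> []" "last u = True" by (auto split: if_splits)
    with Cons.IH obtain c where c: "composition c" "comp_word c = u" by auto
    with \<open>u \<noteq> []\<close> obtain a d where "c = a # d" by (cases c) (auto simp: comp_word_def)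
    with c False show ?thesis
      by (intro exI[of _ "Suc a # d"]) (cases a; auto simp: composition_def comp_word_def)
  qed
qed

lemma last_comp_word: "c \<noteq> [] \<Longrightarrow> last (comp_word c) = True"
  by (cases c rule: rev_cases) (auto simp: comp_word_def)

lemma bij_betw_comp_word:
  "bij_betw comp_word {c. composition c} {u. u = [] \<or> last u = True}"
proof -
  have "comp_word [] = []" by (simp add: comp_word_def)
  then show ?thesis
    unfolding bij_betw_def inj_on_def
    using comp_word_inj comp_word_surj last_comp_word by (auto simp: image_iff) metis+
qed

definition form :: "bool \<Rightarrow> real \<Rightarrow> real" where
  "form \<eta> t = (if \<eta> then 1 / (1 - t) else 1 / t)"

text \<open>The variables \<open>t\<^sub>1, \<dots>, t\<^sub>\<ell>\<close> are \<open>t 0, \<dots>, t (\<ell> - 1)\<close>.\<close>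

definition open_simplex :: "nat \<Rightarrow> (nat \<Rightarrow> real) set" where
  "open_simplex l = {t. 1 > t 0 \<and> (\<forall>i. Suc i < l \<longrightarrow> t i > t (Suc i)) \<and> t (l - 1) > 0}"

definition zeta_int :: "word \<Rightarrow> nat \<Rightarrow> nat \<Rightarrow> real" where
  "zeta_int u p q =
    (LINT t:open_simplex (length u)|(\<Pi>\<^sub>M i\<in>{..<length u}. lborel).
       (1 - t 0) ^ p * (\<Prod>i<length u. form (u ! i) (t i)) * t (length u - 1) ^ q)"

text \<open>The sum of \<open>n\<^sub>1\<^bsup>-c\<^sub>1\<^esup> \<cdots> n\<^sub>r\<^bsup>-c\<^sub>r\<^esup>\<close> over all \<open>n\<^sub>1 > \<cdots> > n\<^sub>r\<close> in \<open>A\<close>.\<close>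

definition nested_sum :: "nat set \<Rightarrow> nat list \<Rightarrow> real" where
  "nested_sum A c =
    (\<Sum>ns\<in>{ns. length ns = length c \<and> sorted_wrt (>) ns \<and> set ns \<subseteq> A}.
       \<Prod>i<length c. 1 / real (ns ! i) ^ (c ! i))"

definition phi :: "nat \<Rightarrow> nat \<Rightarrow> nat list \<Rightarrow> real" where
  "phi p q c = 1 / real q ^ hd c * nested_sum {p<..<q} (tl c)"

definition zeta_trunc :: "nat \<Rightarrow> nat \<Rightarrow> nat list \<Rightarrow> real" where
  "zeta_trunc p q c = nested_sum {p<..q} c"

text \<open>For \<open>w = \<epsilon>\<^sub>1\<dots>\<epsilon>\<^sub>k\<close> and \<open>s = (i, j)\<close>: the factor \<open>\<epsilon>\<^bsub>i+1\<^esub>\<dots>\<epsilon>\<^sub>j\<close>, and the compositions with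
  words \<open>\<epsilon>\<^bsub>j+1\<^esub>\<dots>\<epsilon>\<^sub>k\<close> and (complemented) \<open>\<epsilon>\<^sub>i\<dots>\<epsilon>\<^sub>1\<close>.\<close>

definition mid_word :: "word \<Rightarrow> nat \<times> nat \<Rightarrow> word" where
  "mid_word w s = take (snd s - fst s) (drop (fst s) w)"

definition a_comp :: "word \<Rightarrow> nat \<times> nat \<Rightarrow> nat list" where
  "a_comp w s = word_comp (drop (snd s) w)"

definition b_comp :: "word \<Rightarrow> nat \<times> nat \<Rightarrow> nat list" where
  "b_comp w s = word_comp (map Not (rev (take (fst s) w)))"

definition S_pairs :: "word \<Rightarrow> (nat \<times> nat) set" where
  "S_pairs w = {(i, j). i \<le> j \<and> j \<le> length w \<and>
     mid_word w (i, j) \<noteq> [] \<and> admissible (mid_word w (i, j))}"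

definition lam :: "nat \<Rightarrow> nat \<Rightarrow> bool \<Rightarrow> bool \<Rightarrow> real" where
  "lam p q \<epsilon> \<epsilon>' =
     1 + (if \<epsilon> then 0 else real p / real q) + (if \<epsilon>' then real q / real p else 0)"

end

theory Submission
  imports Defs
begin

text \<open>Write \<open>1/t = (1-t)/t + 1\<close> in the variable \<open>t\<^sub>1\<close> and \<open>1/(1-t) = t/(1-t) + 1\<close> in the variable \<open>t\<^sub>\<ell>\<close>,
  and integrate out the variable on which the form has disappeared. For an admissible word \<open>0v1\<close>
  this expresses the integral with exponents \<open>(m, n)\<close> through those of \<open>0v1\<close>, \<open>v1\<close>, \<open>0v\<close> and \<open>v\<close> with
  exponents \<open>(p, q) = (m+1, n+1)\<close>. For the latter, a leading 1 contributes just a factor \<open>1/p\<close> and a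
  trailing 0 a factor \<open>1/q\<close>, so that every word reduces to an admissible one or to the empty word,
  which counts as the inverse of the binomial coefficient \<open>p+q\<close> over \<open>p\<close>. Inserting this into the
  sum over \<open>S\<close> raises \<open>N\<close> by one: the truncated zeta values absorb the powers of \<open>1/p\<close> and \<open>1/q\<close>, and the
  empty words give the term \<open>M = N + 1\<close>.\<close>

section \<open>Combinatorics of a single step\<close>

text \<open>Here \<open>J i j\<close> is the integral of the factor \<open>\<epsilon>\<^bsub>i+1\<^esub>\<dots>\<epsilon>\<^sub>j\<close>, while \<open>B\<close>, \<open>\<phi>\<close> are attached to prefixes and
  \<open>A\<close>, \<open>\<psi>\<close> to suffixes. The products \<open>\<phi> i * J i j\<close> telescope in \<open>i\<close> (and \<open>\<psi> j * J i j\<close> in \<open>j\<close>), because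
  consecutive ones differ only at the letter 0 (respectively 1).\<close>

lemma telescoping_step:
  fixes B \<phi> A \<psi> :: "nat \<Rightarrow> real" and J :: "nat \<Rightarrow> nat \<Rightarrow> real" and e :: "nat \<Rightarrow> bool"
  assumes p: "p > 0" and q: "q > 0"
    and Jd: "\<And>i. i \<le> k \<Longrightarrow> J i i = c"
    and J1: "\<And>i j. e i \<Longrightarrow> i < j \<Longrightarrow> j \<le> k \<Longrightarrow> J i j = J (Suc i) j / p"
    and J0: "\<And>i j. \<not> e j \<Longrightarrow> i \<le> j \<Longrightarrow> j < k \<Longrightarrow> J i (Suc j) = J i j / q"
    and \<phi>0: "\<phi> 0 = 0" and \<phi>S: "\<And>i. i < k \<Longrightarrow> \<phi> (Suc i) = (if e i then \<phi> i else B i) / p"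
    and \<psi>k: "\<psi> k = 0" and \<psi>S: "\<And>i. i < k \<Longrightarrow> \<psi> i = (if e i then A (Suc i) else \<psi> (Suc i)) / q"
  defines "P \<equiv> {(i, j). i < j \<and> j < k \<and> \<not> e i \<and> e j}"
  shows "(\<Sum>(i, j)\<in>P. B i * A (Suc j) *
            (J i (Suc j) + J (Suc i) (Suc j) / p + J i j / q + J (Suc i) j / (p * q))) =
         (\<Sum>(i, j)\<in>P. (B i + \<phi> i) * (A (Suc j) + \<psi> (Suc j)) * J i (Suc j)) +
         c * (\<Sum>i = 1..k - 1. \<phi> i * \<psi> i *
                (1 + (if e (i - 1) then 0 else p / q) + (if e i then q / p else 0)))"
proof -
  define E where "E = {j. j < k \<and> e j}"
  define O' where "O' = {i. i < k \<and> \<not> e i}"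
  define I where "I j = {i. i < j \<and> \<not> e i}" for j
  \<comment> \<open>The case \<open>j = i\<close> is included to match the range
    \<open>{i..<k}\<close> that telescopes in \<open>R\<close>. For \<open>i\<close> in
    \<open>O'\<close> the letter is 0, so \<open>H i\<close> then contains only
    \<open>j > i\<close>.\<close>
  define H where "H i = {j. i \<le> j \<and> j < k \<and> e j}" for i
  have fin: "finite E" "finite O'" "finite (I j)" "finite (H i)" for i j
    by (auto simp: E_def O'_def I_def H_def)
  have sumJ: "(\<Sum>(i, j)\<in>P. F i j) = (\<Sum>j\<in>E. \<Sum>i\<in>I j. F i j)" for F :: "nat \<Rightarrow> nat \<Rightarrow> real"
  proof -
    have "(\<Sum>j\<in>E. \<Sum>i\<in>I j. F i j) = (\<Sum>(j, i)\<in>Sigma E I. F i j)"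
      using fin by (subst sum.Sigma) auto
    also have "\<dots> = (\<Sum>(i, j)\<in>P. F i j)"
      by (rule sum.reindex_bij_witness[of _ "\<lambda>(i, j). (j, i)" "\<lambda>(i, j). (j, i)"])
        (auto simp: P_def E_def I_def)
    finally show ?thesis by simp
  qed
  have sumI: "(\<Sum>(i, j)\<in>P. F i j) = (\<Sum>i\<in>O'. \<Sum>j\<in>H i. F i j)" for F :: "nat \<Rightarrow> nat \<Rightarrow> real"
  proof -
    have "Sigma O' H = P"
      by (auto simp: P_def O'_def H_def) (metis le_neq_implies_less)
    then show ?thesis
      using fin by (subst sum.Sigma) auto
  qed
  \<comment> \<open>\<open>\<phi> i * J i j\<close> telescopes from \<open>i = 0\<close>, where
    \<open>\<phi>\<close> vanishes, to \<open>i = j\<close>, where \<open>J j j = c\<close>. At a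
    letter 1 the factor 1/p merely passes from \<open>J\<close> to \<open>\<phi>\<close>, so only
    the letters 0 contribute.\<close>
  have L: "(\<Sum>i\<in>I j. B i * J (Suc i) j / p) = (\<Sum>i\<in>I j. \<phi> i * J i j) + c * \<phi> j"
    if "j \<le> k" for j
  proof -
    have "c * \<phi> j = (\<Sum>i<j. \<phi> (Suc i) * J (Suc i) j - \<phi> i * J i j)"
      using that by (subst sum_lessThan_telescope) (auto simp: Jd \<phi>0)
    also have "\<dots> = (\<Sum>i<j. if \<not> e i then B i * J (Suc i) j / p - \<phi> i * J i j else 0)"
      using that p by (intro sum.cong) (auto simp: \<phi>S J1)
    also have "\<dots> = (\<Sum>i\<in>I j. B i * J (Suc i) j / p - \<phi> i * J i j)"
      unfolding I_def using sum.inter_filter[of "{..<j}" "\<lambda>i. B i * J (Suc i) j / p - \<phi> i * J i j" "\<lambda>i. \<not> e i"]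
      by (simp add: lessThan_def)
    finally show ?thesis by (simp add: sum_subtractf)
  qed
  \<comment> \<open>Mirror image of \<open>L\<close> in the right end: the sum starts at
    \<open>J i i = c\<close> and ends at \<open>\<psi> k = 0\<close>, whence the minus sign, and
    only the letters 1 contribute.\<close>
  have R: "(\<Sum>j\<in>H i. A (Suc j) * J i j / q) = (\<Sum>j\<in>H i. \<psi> (Suc j) * J i (Suc j)) + c * \<psi> i"
    if "i \<le> k" for i
  proof -
    have "c * \<psi> i = - (\<Sum>j = i..<k. \<psi> (Suc j) * J i (Suc j) - \<psi> j * J i j)"
      using that by (subst sum_Suc_diff') (auto simp: Jd \<psi>k)
    also have "\<dots> = (\<Sum>j = i..<k. if e j then A (Suc j) * J i j / q - \<psi> (Suc j) * J i (Suc j) else 0)"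
      unfolding sum_negf[symmetric] using that q by (intro sum.cong) (auto simp: \<psi>S J0)
    also have "\<dots> = (\<Sum>j\<in>H i. A (Suc j) * J i j / q - \<psi> (Suc j) * J i (Suc j))"
      unfolding H_def using sum.inter_filter[of "{i..<k}" "\<lambda>j. A (Suc j) * J i j / q - \<psi> (Suc j) * J i (Suc j)" e]
      by (simp add: atLeastLessThan_def atLeast_def lessThan_def conj_ac Int_def)
    finally show ?thesis by (simp add: sum_subtractf)
  qed
  have T2: "(\<Sum>(i, j)\<in>P. B i * A (Suc j) * J (Suc i) (Suc j) / p) =
      (\<Sum>(i, j)\<in>P. \<phi> i * A (Suc j) * J i (Suc j)) + c * (\<Sum>j\<in>E. A (Suc j) * \<phi> (Suc j))"
  proof -
    \<comment> \<open>Position \<open>j\<close> carries the letter 1 and so is no left end;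
      \<open>L\<close> can therefore be used with right end \<open>Suc j\<close>.\<close>
    have "I j = I (Suc j)" if "j \<in> E" for j
      using that by (auto simp: I_def E_def less_Suc_eq)
    then have "(\<Sum>(i, j)\<in>P. B i * A (Suc j) * J (Suc i) (Suc j) / p) =
        (\<Sum>j\<in>E. A (Suc j) * (\<Sum>i\<in>I (Suc j). B i * J (Suc i) (Suc j) / p))"
      unfolding sumJ sum_distrib_left by (intro sum.cong) auto
    also have "\<dots> = (\<Sum>j\<in>E. A (Suc j) * ((\<Sum>i\<in>I j. \<phi> i * J i (Suc j)) + c * \<phi> (Suc j)))"
      using \<open>\<And>j. j \<in> E \<Longrightarrow> I j = I (Suc j)\<close> by (intro sum.cong refl) (subst L, auto simp: E_def)
    finally show ?thesis
      by (simp add: sumJ sum_distrib_left sum_distrib_right sum.distrib algebra_simps)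
  qed
  have T3: "(\<Sum>(i, j)\<in>P. B i * A (Suc j) * J i j / q) =
      (\<Sum>(i, j)\<in>P. B i * \<psi> (Suc j) * J i (Suc j)) + c * (\<Sum>i\<in>O'. B i * \<psi> i)"
  proof -
    have "(\<Sum>(i, j)\<in>P. B i * A (Suc j) * J i j / q) =
        (\<Sum>i\<in>O'. B i * (\<Sum>j\<in>H i. A (Suc j) * J i j / q))"
      unfolding sumI sum_distrib_left by (intro sum.cong) auto
    also have "\<dots> = (\<Sum>i\<in>O'. B i * ((\<Sum>j\<in>H i. \<psi> (Suc j) * J i (Suc j)) + c * \<psi> i))"
      by (intro sum.cong refl, subst R) (auto simp: O'_def)
    finally show ?thesis
      by (simp add: sumI sum_distrib_left sum_distrib_right sum.distrib algebra_simps)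
  qed
  have T4: "(\<Sum>(i, j)\<in>P. B i * A (Suc j) * J (Suc i) j / (p * q)) =
      (\<Sum>(i, j)\<in>P. \<phi> i * \<psi> (Suc j) * J i (Suc j)) + c * (\<Sum>i<k. \<phi> i * \<psi> i)"
  proof -
    have "(\<Sum>(i, j)\<in>P. B i * A (Suc j) * J (Suc i) j / (p * q)) =
        (\<Sum>j\<in>E. \<psi> j * (\<Sum>i\<in>I j. B i * J (Suc i) j / p))"
      unfolding sumJ sum_distrib_left by (intro sum.cong) (auto simp: E_def \<psi>S mult_ac)
    also have "\<dots> = (\<Sum>j\<in>E. \<psi> j * ((\<Sum>i\<in>I j. \<phi> i * J i j) + c * \<phi> j))"
      by (intro sum.cong refl, subst L) (auto simp: E_def)
    also have "\<dots> = (\<Sum>(i, j)\<in>P. \<phi> i * \<psi> j * J i j) + c * (\<Sum>j\<in>E. \<phi> j * \<psi> j)"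
      by (simp add: sumJ sum_distrib_left sum_distrib_right sum.distrib algebra_simps)
    \<comment> \<open>At a letter 1, \<open>\<psi> j = A (Suc j) / q\<close>, which puts the sum
      left over by \<open>L\<close> into the form of \<open>R\<close>. The two boundary sums run
      over the letters 1 and the letters 0, together over all positions.\<close>
    also have "(\<Sum>(i, j)\<in>P. \<phi> i * \<psi> j * J i j) = (\<Sum>i\<in>O'. \<phi> i * (\<Sum>j\<in>H i. A (Suc j) * J i j / q))"
      unfolding sumI sum_distrib_left by (intro sum.cong) (auto simp: H_def \<psi>S)
    also have "\<dots> = (\<Sum>i\<in>O'. \<phi> i * ((\<Sum>j\<in>H i. \<psi> (Suc j) * J i (Suc j)) + c * \<psi> i))"
      by (intro sum.cong refl, subst R) (auto simp: O'_def)
    also have "\<dots> = (\<Sum>(i, j)\<in>P. \<phi> i * \<psi> (Suc j) * J i (Suc j)) + c * (\<Sum>i\<in>O'. \<phi> i * \<psi> i)"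
      by (simp add: sumI sum_distrib_left sum_distrib_right sum.distrib algebra_simps)
    finally have "(\<Sum>(i, j)\<in>P. B i * A (Suc j) * J (Suc i) j / (p * q)) =
      (\<Sum>(i, j)\<in>P. \<phi> i * \<psi> (Suc j) * J i (Suc j)) +
      c * ((\<Sum>j\<in>E. \<phi> j * \<psi> j) + (\<Sum>i\<in>O'. \<phi> i * \<psi> i))"
      by (simp add: algebra_simps)
    moreover have "(\<Sum>j\<in>E. \<phi> j * \<psi> j) + (\<Sum>i\<in>O'. \<phi> i * \<psi> i) = (\<Sum>i\<in>E \<union> O'. \<phi> i * \<psi> i)"
      using fin by (intro sum.union_disjoint[symmetric]) (auto simp: E_def O'_def)
    moreover have "E \<union> O' = {..<k}" by (auto simp: E_def O'_def)
    ultimately show ?thesis by simp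
  qed
  have shift: "(\<Sum>i<k. F i) = (\<Sum>i = 1..k - 1. F i)" if "F 0 = 0" for F :: "nat \<Rightarrow> real"
    using that by (intro sum.mono_neutral_right) (auto simp: not_le)
  \<comment> \<open>At a letter 1, \<open>A (Suc j) = q * \<psi> j\<close> and
    \<open>\<phi> (Suc j) = \<phi> j / p\<close>.\<close>
  have bE: "(\<Sum>j\<in>E. A (Suc j) * \<phi> (Suc j)) = (\<Sum>i = 1..k - 1. \<phi> i * \<psi> i * (if e i then q / p else 0))"
  proof -
    have "(\<Sum>j\<in>E. A (Suc j) * \<phi> (Suc j)) = (\<Sum>j\<in>E. \<phi> j * \<psi> j * (q / p))"
      using p q by (intro sum.cong) (auto simp: E_def \<phi>S \<psi>S)
    also have "\<dots> = (\<Sum>j<k. if e j then \<phi> j * \<psi> j * (q / p) else 0)"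
      unfolding E_def using sum.inter_filter[of "{..<k}" "\<lambda>j. \<phi> j * \<psi> j * (q / p)" e] by (simp add: lessThan_def)
    also have "\<dots> = (\<Sum>i = 1..k - 1. if e i then \<phi> i * \<psi> i * (q / p) else 0)"
      by (rule shift) (simp add: \<phi>0)
    finally show ?thesis by (simp add: if_distrib cong: if_cong)
  qed
  \<comment> \<open>At a letter 0, \<open>B i = p * \<phi> (Suc i)\<close> and
    \<open>\<psi> i = \<psi> (Suc i) / q\<close>. Both values sit at \<open>Suc i\<close>, so
    reindexing turns the letter into \<open>e (i - 1)\<close>; the top term \<open>i = k\<close>
    vanishes with \<open>\<psi> k\<close>.\<close>
  have bO: "(\<Sum>i\<in>O'. B i * \<psi> i) = (\<Sum>i = 1..k - 1. \<phi> i * \<psi> i * (if e (i - 1) then 0 else p / q))"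
  proof -
    have "(\<Sum>i\<in>O'. B i * \<psi> i) = (\<Sum>i\<in>O'. \<phi> (Suc i) * \<psi> (Suc i) * (p / q))"
      using p q by (intro sum.cong) (auto simp: O'_def \<phi>S \<psi>S)
    also have "\<dots> = (\<Sum>i<k. if \<not> e i then \<phi> (Suc i) * \<psi> (Suc i) * (p / q) else 0)"
      unfolding O'_def using sum.inter_filter[of "{..<k}" "\<lambda>i. \<phi> (Suc i) * \<psi> (Suc i) * (p / q)" "\<lambda>i. \<not> e i"]
      by (simp add: lessThan_def)
    also have "\<dots> = (\<Sum>i = 1..k. if \<not> e (i - 1) then \<phi> i * \<psi> i * (p / q) else 0)"
      by (rule sum.reindex_bij_witness[of _ "\<lambda>i. i - 1" Suc]) auto
    also have "\<dots> = (\<Sum>i = 1..k - 1. if \<not> e (i - 1) then \<phi> i * \<psi> i * (p / q) else 0)"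
    proof (rule sum.mono_neutral_right)
      have "i = k" if "i \<in> {1..k} - {1..k - 1}" for i using that by auto
      then show "\<forall>i\<in>{1..k} - {1..k - 1}. (if \<not> e (i - 1) then \<phi> i * \<psi> i * (p / q) else 0) = 0"
        using \<psi>k by (metis (no_types, lifting) mult_eq_0_iff)
    qed auto
    also have "\<dots> = (\<Sum>i = 1..k - 1. \<phi> i * \<psi> i * (if e (i - 1) then 0 else p / q))"
      by (intro sum.cong) auto
    finally show ?thesis .
  qed
  have bA: "(\<Sum>i<k. \<phi> i * \<psi> i) = (\<Sum>i = 1..k - 1. \<phi> i * \<psi> i)"
    by (rule shift) (simp add: \<phi>0)
  have "(\<Sum>(i, j)\<in>P. B i * A (Suc j) *
            (J i (Suc j) + J (Suc i) (Suc j) / p + J i j / q + J (Suc i) j / (p * q))) =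
      (\<Sum>(i, j)\<in>P. B i * A (Suc j) * J i (Suc j)) +
      (\<Sum>(i, j)\<in>P. B i * A (Suc j) * J (Suc i) (Suc j) / p) +
      (\<Sum>(i, j)\<in>P. B i * A (Suc j) * J i j / q) +
      (\<Sum>(i, j)\<in>P. B i * A (Suc j) * J (Suc i) j / (p * q))"
    by (simp add: sum.distrib[symmetric] case_prod_unfold distrib_left)
  also have "\<dots> = (\<Sum>(i, j)\<in>P. (B i + \<phi> i) * (A (Suc j) + \<psi> (Suc j)) * J i (Suc j)) +
      c * ((\<Sum>j\<in>E. A (Suc j) * \<phi> (Suc j)) + (\<Sum>i\<in>O'. B i * \<psi> i) + (\<Sum>i<k. \<phi> i * \<psi> i))"
    unfolding T2 T3 T4 by (simp add: sum.distrib case_prod_unfold algebra_simps)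
  also have "(\<Sum>j\<in>E. A (Suc j) * \<phi> (Suc j)) + (\<Sum>i\<in>O'. B i * \<psi> i) + (\<Sum>i<k. \<phi> i * \<psi> i) =
      (\<Sum>i = 1..k - 1. \<phi> i * \<psi> i *
                (1 + (if e (i - 1) then 0 else p / q) + (if e i then q / p else 0)))"
    unfolding bE bO bA by (simp add: sum.distrib[symmetric] distrib_left add_ac)
  finally show ?thesis .
qed

section \<open>Words, compositions and nested sums\<close>

lemma word_comp_comp_word: "composition c \<Longrightarrow> word_comp (comp_word c) = c"
  unfolding word_comp_def using comp_word_inj by (intro the_equality) auto

lemma word_comp_Nil: "word_comp [] = []"
  using word_comp_comp_word[of "[]"] by (simp add: composition_def comp_word_def)

lemma word_comp_True:
  assumes "u = [] \<or> last u"
  shows "word_comp (True # u) = 1 # word_comp u"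
proof -
  obtain c where c: "composition c" "comp_word c = u"
    using comp_word_surj assms by auto
  then have "composition (1 # c)" "comp_word (1 # c) = True # u"
    by (auto simp: composition_def comp_word_def)
  with c show ?thesis by (metis word_comp_comp_word)
qed

text \<open>A letter 0 in front lengthens the first block of zeros. Naming head and tail lets the
  values of \<open>phi\<close> be compared directly: only the exponent of the top index
  changes.\<close>

lemma word_comp_False:
  assumes "u \<noteq> []" "last u"
  obtains a d where "word_comp u = a # d" "word_comp (False # u) = Suc a # d"
proof -
  obtain c where c: "composition c" "comp_word c = u"
    using comp_word_surj assms by auto
  then obtain a d where ad: "c = a # d"
    using assms by (cases c) (auto simp: comp_word_def)
  with c have "composition (Suc a # d)" "comp_word (Suc a # d) = False # u"
    by (cases a; auto simp: composition_def comp_word_def)+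
  with c ad that show ?thesis by (metis word_comp_comp_word)
qed

lemma nested_sum_Nil: "nested_sum A [] = 1"
proof -
  have "{ns. length ns = length [] \<and> sorted_wrt (>) ns \<and> set ns \<subseteq> A} = {[]}" by auto
  then show ?thesis by (simp add: nested_sum_def)
qed

lemma finite_decreasing_lists:
  "finite A \<Longrightarrow> finite {ns. length ns = l \<and> sorted_wrt (>) ns \<and> set ns \<subseteq> (A :: nat set)}"
  by (rule finite_subset[OF _ finite_lists_length_eq[of A l]]) auto

text \<open>As \<open>Q\<close> exceeds every element of \<open>A\<close>, a decreasing list can
  contain it only as its head.\<close>

lemma nested_sum_insert_max:
  assumes A: "finite A" "\<And>x. x \<in> A \<Longrightarrow> x < Q"
  shows "nested_sum (insert Q A) (c # cs) =
    nested_sum A (c # cs) + 1 / real Q ^ c * nested_sum A cs"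
proof -
  let ?D = "\<lambda>l A. {ns. length ns = l \<and> sorted_wrt (>) ns \<and> set ns \<subseteq> (A :: nat set)}"
  let ?f = "\<lambda>c ns. \<Prod>i<length c. 1 / real (ns ! i) ^ (c ! i)"
  let ?l = "length cs"
  have D: "?D (Suc ?l) (insert Q A) = ?D (Suc ?l) A \<union> (#) Q ` ?D ?l A"
  proof (intro set_eqI iffI)
    fix ns assume ns: "ns \<in> ?D (Suc ?l) (insert Q A)"
    then obtain x xs where x: "ns = x # xs" by (cases ns) auto
    have "set xs \<subseteq> A"
    proof
      fix y assume y: "y \<in> set xs"
      then have "y < x" "y \<in> insert Q A" "x \<in> insert Q A" using ns x by auto
      then show "y \<in> A" using A(2) by fastforce
    qed
    then show "ns \<in> ?D (Suc ?l) A \<union> (#) Q ` ?D ?l A" using ns x by auto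
  next
    fix ns assume "ns \<in> ?D (Suc ?l) A \<union> (#) Q ` ?D ?l A"
    then show "ns \<in> ?D (Suc ?l) (insert Q A)" using A(2) by (auto simp: subset_iff)
  qed
  have "nested_sum (insert Q A) (c # cs) =
      (\<Sum>ns\<in>?D (Suc ?l) A. ?f (c # cs) ns) + (\<Sum>ns\<in>(#) Q ` ?D ?l A. ?f (c # cs) ns)"
    unfolding nested_sum_def list.size(4) One_nat_def add_Suc_right add_0_right D
  proof (rule sum.union_disjoint)
    show "?D (Suc ?l) A \<inter> (#) Q ` ?D ?l A = {}"
      using A(2)[of Q] by auto
  qed (use finite_decreasing_lists[OF A(1)] in auto)
  also have "(\<Sum>ns\<in>(#) Q ` ?D ?l A. ?f (c # cs) ns) = (\<Sum>ns\<in>?D ?l A. 1 / real Q ^ c * ?f cs ns)"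
    by (subst sum.reindex) (auto simp: prod.lessThan_Suc_shift o_def inj_on_def simp del: prod.lessThan_Suc)
  finally show ?thesis by (simp add: nested_sum_def sum_distrib_left)
qed

text \<open>The new terms are those with largest index \<open>n + Suc N\<close>, and
  \<open>phi\<close> is their sum. The empty composition has value 1 for every range and gains
  nothing.\<close>

lemma zeta_trunc_Suc:
  "zeta_trunc n (n + Suc N) c =
    zeta_trunc n (n + N) c + (if c = [] then 0 else phi n (n + Suc N) c)"
proof (cases c)
  case Nil
  then show ?thesis by (simp add: zeta_trunc_def nested_sum_Nil)
next
  case (Cons a d)
  have "{n<..n + Suc N} = insert (n + Suc N) {n<..n + N}" "{n<..<n + Suc N} = {n<..n + N}" by auto
  then show ?thesis
    using nested_sum_insert_max[of "{n<..n + N}" "n + Suc N" a d] Cons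
    by (simp add: zeta_trunc_def phi_def)
qed

text \<open>The value at the empty word is a convention, making the recursions below uniform.\<close>

definition phi_word :: "nat \<Rightarrow> nat \<Rightarrow> word \<Rightarrow> real" where
  "phi_word p q u = (if u = [] then 0 else phi p q (word_comp u))"

text \<open>Supplies the recursions for \<open>\<phi>\<close> and \<open>\<psi>\<close> in
  \<open>telescoping_step\<close>. A letter 1 opens a new part 1, whose index is the top one, before
  a truncated sum for \<open>u\<close>; a letter 0 raises the exponent of the top index. The second
  assumption excludes the word 0, to which no composition belongs.\<close>

lemma phi_word_Cons:
  assumes "u = [] \<or> last u" "u \<noteq> [] \<or> x"
  shows "phi_word n (n + Suc N) (x # u) =
    (if x then zeta_trunc n (n + N) (word_comp u) else phi_word n (n + Suc N) u) / real (n + Suc N)"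
proof (cases x)
  case True
  have "{n<..<n + Suc N} = {n<..n + N}" by auto
  then show ?thesis using True assms(1) word_comp_True[of u]
    by (auto simp: phi_word_def phi_def zeta_trunc_def)
next
  case False
  with assms obtain a d where "word_comp u = a # d" "word_comp (False # u) = Suc a # d"
    using word_comp_False[of u] by metis
  with False assms show ?thesis by (auto simp: phi_word_def phi_def)
qed

lemma word_comp_eq_Nil_iff:
  assumes "u = [] \<or> last u"
  shows "word_comp u = [] \<longleftrightarrow> u = []"
  using assms by (cases u; cases "hd u"; cases "tl u = []")
    (auto simp: word_comp_Nil word_comp_True elim: word_comp_False)

lemma zeta_trunc_word_Suc:
  assumes "u = [] \<or> last u"
  shows "zeta_trunc n (n + Suc N) (word_comp u) =
    zeta_trunc n (n + N) (word_comp u) + phi_word n (n + Suc N) u"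
  unfolding zeta_trunc_Suc phi_word_def word_comp_eq_Nil_iff[OF assms] by simp

text \<open>At \<open>N = 0\<close> no index is available. This reduces the sum over
  \<open>S\<close> to the single factor \<open>w\<close>, the start of the induction.\<close>

lemma zeta_trunc_word_empty_range:
  assumes "u = [] \<or> last u"
  shows "zeta_trunc n (n + 0) (word_comp u) = (if u = [] then 1 else 0)"
proof (cases "u = []")
  case True
  then show ?thesis by (simp add: zeta_trunc_def word_comp_Nil nested_sum_Nil)
next
  case False
  then have "{ns. length ns = length (word_comp u) \<and> sorted_wrt (>) ns \<and> set ns \<subseteq> {n<..n + 0}} = {}"
    using word_comp_eq_Nil_iff[OF assms] by auto
  then show ?thesis using False unfolding zeta_trunc_def nested_sum_def by (simp only: sum.empty if_False)
qed

section \<open>Iterated integrals\<close>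

text \<open>The factor \<open>indicator {0<..<1} s\<close> is redundant for the integrals below; with it the identities for
  \<open>unit_mon\<close> hold as equalities of functions on the whole line.\<close>

definition iter_op :: "bool \<Rightarrow> (real \<Rightarrow> ennreal) \<Rightarrow> real \<Rightarrow> ennreal" where
  "iter_op \<eta> g s = indicator {0<..<1} s *
     (\<integral>\<^sup>+r. ennreal (form \<eta> r) * g r * indicator {0<..<s} r \<partial>lborel)"

text \<open>No form is built in: that of the first letter is put into \<open>h\<close>, so that the
  operator still applies once this form has cancelled. Values in \<open>ennreal\<close> allow Fubini
  and the splitting of sums before convergence is known.\<close>

definition outer :: "nat \<Rightarrow> (real \<Rightarrow> ennreal) \<Rightarrow> ennreal" where
  "outer p h = (\<integral>\<^sup>+t. ennreal ((1 - t) ^ p) * h t * indicator {0<..<1} t \<partial>lborel)"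

definition unit_mon :: "nat \<Rightarrow> real \<Rightarrow> ennreal" where
  "unit_mon q t = indicator {0<..<1} t * ennreal (t ^ q)"

lemma form_measurable [measurable]: "form \<eta> \<in> borel_measurable borel"
  unfolding form_def by measurable

lemma form_pos: "0 < t \<Longrightarrow> t < 1 \<Longrightarrow> 0 < form \<eta> t"
  by (simp add: form_def)

lemma unit_mon_measurable [measurable]: "unit_mon q \<in> borel_measurable borel"
  unfolding unit_mon_def by measurable

lemma iter_op_measurable [measurable (raw)]:
  assumes [measurable]: "g \<in> borel_measurable borel"
  shows "iter_op \<eta> g \<in> borel_measurable borel"
proof -
  have "(\<lambda>(s, r). ennreal (form \<eta> r) * g r * indicator {0<..<s} r)
      = (\<lambda>(s, r). ennreal (form \<eta> r) * g r * (if 0 < r \<and> r < s then 1 else 0))"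
    by (auto simp: fun_eq_iff indicator_def)
  also have "\<dots> \<in> borel_measurable (borel \<Otimes>\<^sub>M lborel)"
    by measurable
  finally have [measurable]: "(\<lambda>s. \<integral>\<^sup>+r. ennreal (form \<eta> r) * g r * indicator {0<..<s} r \<partial>lborel)
      \<in> borel_measurable borel"
    by (intro lborel.borel_measurable_nn_integral)
  show ?thesis unfolding iter_op_def by measurable
qed

lemma foldr_iter_op_measurable [measurable (raw)]:
  "g \<in> borel_measurable borel \<Longrightarrow> foldr iter_op u g \<in> borel_measurable borel"
  by (induction u) auto

text \<open>The shape \<open>f + c * g\<close> is that of the identities for \<open>iter_op\<close>
  on \<open>unit_mon\<close> below; linearity carries them through all preceding letters.\<close>

lemma iter_op_linear:
  assumes [measurable]: "f \<in> borel_measurable borel" "g \<in> borel_measurable borel"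
  shows "iter_op \<eta> (\<lambda>t. f t + c * g t) = (\<lambda>t. iter_op \<eta> f t + c * iter_op \<eta> g t)"
proof
  fix s
  have "(\<integral>\<^sup>+r. ennreal (form \<eta> r) * (f r + c * g r) * indicator {0<..<s} r \<partial>lborel) =
      (\<integral>\<^sup>+r. ennreal (form \<eta> r) * f r * indicator {0<..<s} r +
        c * (ennreal (form \<eta> r) * g r * indicator {0<..<s} r) \<partial>lborel)"
    by (simp add: distrib_left distrib_right mult_ac)
  also have "\<dots> = (\<integral>\<^sup>+r. ennreal (form \<eta> r) * f r * indicator {0<..<s} r \<partial>lborel) +
      c * (\<integral>\<^sup>+r. ennreal (form \<eta> r) * g r * indicator {0<..<s} r \<partial>lborel)"
    by (subst nn_integral_add) (auto simp: nn_integral_cmult)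
  finally show "iter_op \<eta> (\<lambda>t. f t + c * g t) s = iter_op \<eta> f s + c * iter_op \<eta> g s"
    by (simp add: iter_op_def distrib_left mult_ac)
qed

lemma foldr_iter_op_linear:
  assumes "f \<in> borel_measurable borel" "g \<in> borel_measurable borel"
  shows "foldr iter_op u (\<lambda>t. f t + c * g t) = (\<lambda>t. foldr iter_op u f t + c * foldr iter_op u g t)"
  using assms by (induction u) (auto simp: iter_op_linear foldr_iter_op_measurable)

lemma outer_linear:
  assumes [measurable]: "f \<in> borel_measurable borel" "g \<in> borel_measurable borel"
  shows "outer p (\<lambda>t. f t + c * g t) = outer p f + c * outer p g"
proof -
  have "outer p (\<lambda>t. f t + c * g t) =
      (\<integral>\<^sup>+t. ennreal ((1 - t) ^ p) * f t * indicator {0<..<1} t +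
        c * (ennreal ((1 - t) ^ p) * g t * indicator {0<..<1} t) \<partial>lborel)"
    by (simp add: outer_def distrib_left distrib_right mult_ac)
  also have "\<dots> = outer p f + c * outer p g"
    unfolding outer_def by (subst nn_integral_add) (auto simp: nn_integral_cmult)
  finally show ?thesis .
qed

lemma outer_cong:
  assumes "\<And>t. 0 < t \<Longrightarrow> t < 1 \<Longrightarrow> ennreal ((1 - t) ^ p) * f t = ennreal ((1 - t) ^ p') * g t"
  shows "outer p f = outer p' g"
  unfolding outer_def using assms by (intro nn_integral_cong) (auto simp: indicator_def)

section \<open>Integrating out the outermost or the innermost variable\<close>

lemma nn_integral_Ioo_power:
  assumes "0 \<le> t"
  shows "(\<integral>\<^sup>+r. ennreal (r ^ q) * indicator {0<..<t} r \<partial>lborel) = ennreal (t ^ Suc q / Suc q)"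
proof -
  have "(\<integral>\<^sup>+r. ennreal (r ^ q) * indicator {0<..<t} r \<partial>lborel) =
      (\<integral>\<^sup>+r. ennreal (r ^ q) * indicator {0..t} r \<partial>lborel)"
  proof (rule nn_integral_cong_AE)
    show "AE x in lborel. ennreal (x ^ q) * indicator {0<..<t} x = ennreal (x ^ q) * indicator {0..t} x"
      using AE_lborel_singleton[of 0] AE_lborel_singleton[of t]
      by eventually_elim (auto simp: indicator_def)
  qed
  also have "\<dots> = ennreal (t ^ Suc q / Suc q - 0 ^ Suc q / Suc q)"
  proof (rule nn_integral_FTC_Icc)
    fix x
    show "((\<lambda>r. r ^ Suc q / real (Suc q)) has_real_derivative x ^ q) (at x)"
      using DERIV_cdivide[OF DERIV_pow[of "Suc q" x UNIV], of "real (Suc q)"]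
      by (simp del: power_Suc of_nat_Suc)
  qed (use assms in auto)
  finally show ?thesis by simp
qed

lemma nn_integral_Ioo_one_minus_power:
  assumes "r \<le> 1"
  shows "(\<integral>\<^sup>+t. ennreal ((1 - t) ^ p) * indicator {r<..<1} t \<partial>lborel) =
    ennreal ((1 - r) ^ Suc p / Suc p)"
proof -
  have "(\<integral>\<^sup>+t. ennreal ((1 - t) ^ p) * indicator {r<..<1} t \<partial>lborel) =
      (\<integral>\<^sup>+t. ennreal ((1 - t) ^ p) * indicator {r..1} t \<partial>lborel)"
  proof (rule nn_integral_cong_AE)
    show "AE x in lborel. ennreal ((1 - x) ^ p) * indicator {r<..<1} x = ennreal ((1 - x) ^ p) * indicator {r..1} x"
      using AE_lborel_singleton[of r] AE_lborel_singleton[of 1]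
      by eventually_elim (auto simp: indicator_def)
  qed
  also have "\<dots> = ennreal (- ((1 - 1) ^ Suc p / Suc p) - (- ((1 - r) ^ Suc p / Suc p)))"
  proof (rule nn_integral_FTC_Icc)
    fix x :: real
    have D: "((\<lambda>t. 1 - t) has_real_derivative 0 - 1) (at x)"
      by (intro DERIV_diff DERIV_const DERIV_ident)
    have "((\<lambda>t. - ((1 - t) ^ Suc p / real (Suc p))) has_real_derivative
        - (real (Suc p) * (1 - x) ^ p * (0 - 1) / real (Suc p))) (at x)"
      by (intro DERIV_minus DERIV_cdivide DERIV_cong[OF DERIV_power_Suc[OF D]])
        (simp add: algebra_simps)
    then show "((\<lambda>t. - ((1 - t) ^ Suc p / real (Suc p))) has_real_derivative (1 - x) ^ p) (at x)"
      by (simp del: power_Suc of_nat_Suc)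
  qed (use assms in auto)
  finally show ?thesis by simp
qed

text \<open>By Fubini the outer variable is integrated first; over the interval from
  \<open>r\<close> to 1 it gives \<open>(1 - r) ^ Suc p / Suc p\<close>, and \<open>r\<close>
  becomes the outermost variable.\<close>

lemma outer_iter_op:
  assumes [measurable]: "g \<in> borel_measurable borel"
  shows "outer p (iter_op \<eta> g) =
    ennreal (1 / Suc p) * outer (Suc p) (\<lambda>t. ennreal (form \<eta> t) * g t)"
proof -
  let ?I = "\<lambda>t r :: real. (if 0 < r \<and> r < t \<and> t < 1 then 1 else 0 :: ennreal)"
  have "outer p (iter_op \<eta> g) =
      (\<integral>\<^sup>+t. \<integral>\<^sup>+r. ennreal ((1 - t) ^ p) * (ennreal (form \<eta> r) * g r * ?I t r) \<partial>lborel \<partial>lborel)"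
    unfolding outer_def
  proof (rule nn_integral_cong)
    fix t
    have "(\<integral>\<^sup>+r. ennreal ((1 - t) ^ p) * (ennreal (form \<eta> r) * g r * ?I t r) \<partial>lborel) =
        ennreal ((1 - t) ^ p) * (\<integral>\<^sup>+r. ennreal (form \<eta> r) * g r * ?I t r \<partial>lborel)"
      by (rule nn_integral_cmult) measurable
    also have "(\<integral>\<^sup>+r. ennreal (form \<eta> r) * g r * ?I t r \<partial>lborel) =
       (\<integral>\<^sup>+r. ennreal (form \<eta> r) * g r * indicator {0<..<t} r * indicator {0<..<1} t \<partial>lborel)"
      by (intro nn_integral_cong) (auto simp: indicator_def)
    also have "\<dots> = iter_op \<eta> g t * indicator {0<..<1} t"
      by (subst nn_integral_multc) (auto simp: iter_op_def indicator_def)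
    finally show "ennreal ((1 - t) ^ p) * iter_op \<eta> g t * indicator {0<..<1} t =
        (\<integral>\<^sup>+r. ennreal ((1 - t) ^ p) * (ennreal (form \<eta> r) * g r * ?I t r) \<partial>lborel)"
      by (simp add: mult_ac)
  qed
  also have "\<dots> = (\<integral>\<^sup>+r. \<integral>\<^sup>+t. ennreal ((1 - t) ^ p) * (ennreal (form \<eta> r) * g r * ?I t r) \<partial>lborel \<partial>lborel)"
    by (rule lborel_pair.Fubini'[symmetric]) measurable
  also have "\<dots> = (\<integral>\<^sup>+r. ennreal (1 / Suc p) *
      (ennreal ((1 - r) ^ Suc p) * (ennreal (form \<eta> r) * g r) * indicator {0<..<1} r) \<partial>lborel)"
  proof (rule nn_integral_cong)
    fix r :: real
    have "(\<integral>\<^sup>+t. ennreal ((1 - t) ^ p) * (ennreal (form \<eta> r) * g r * ?I t r) \<partial>lborel) =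
        (\<integral>\<^sup>+t. (ennreal (form \<eta> r) * g r * indicator {0<..<1} r) *
          (ennreal ((1 - t) ^ p) * indicator {r<..<1} t) \<partial>lborel)"
      by (intro nn_integral_cong) (auto simp: indicator_def mult_ac)
    also have "\<dots> = (ennreal (form \<eta> r) * g r * indicator {0<..<1} r) *
        (\<integral>\<^sup>+t. ennreal ((1 - t) ^ p) * indicator {r<..<1} t \<partial>lborel)"
      by (rule nn_integral_cmult) measurable
    also have "\<dots> = ennreal (1 / Suc p) *
      (ennreal ((1 - r) ^ Suc p) * (ennreal (form \<eta> r) * g r) * indicator {0<..<1} r)"
    proof (cases "r \<in> {0<..<1}")
      case True
      then show ?thesis
        using ennreal_mult[of "1 / Suc p" "(1 - r) ^ Suc p"]
        by (subst nn_integral_Ioo_one_minus_power) (auto simp: mult_ac)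
    qed auto
    finally show "(\<integral>\<^sup>+t. ennreal ((1 - t) ^ p) * (ennreal (form \<eta> r) * g r * ?I t r) \<partial>lborel) =
      ennreal (1 / Suc p) *
      (ennreal ((1 - r) ^ Suc p) * (ennreal (form \<eta> r) * g r) * indicator {0<..<1} r)" .
  qed
  also have "\<dots> = ennreal (1 / Suc p) * outer (Suc p) (\<lambda>t. ennreal (form \<eta> t) * g t)"
    unfolding outer_def by (rule nn_integral_cmult) measurable
  finally show ?thesis .
qed

lemma outer_form_True:
  "outer (Suc p) (\<lambda>t. ennreal (form True t) * h t) = outer p h"
proof (rule outer_cong)
  fix t :: real assume t: "0 < t" "t < 1"
  have "ennreal ((1 - t) ^ Suc p) * ennreal (form True t) = ennreal ((1 - t) ^ p)"
    using t by (subst ennreal_mult[symmetric]) (auto simp: form_def)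
  then show "ennreal ((1 - t) ^ Suc p) * (ennreal (form True t) * h t) = ennreal ((1 - t) ^ p) * h t"
    by (simp add: mult.assoc[symmetric])
qed

lemma outer_form_False:
  assumes [measurable]: "h \<in> borel_measurable borel"
  shows "outer p (\<lambda>t. ennreal (form False t) * h t) =
    outer (Suc p) (\<lambda>t. ennreal (form False t) * h t) + outer p h"
proof -
  have "outer p (\<lambda>t. ennreal (form False t) * h t) =
    (\<integral>\<^sup>+t. ennreal ((1 - t) ^ Suc p) * (ennreal (form False t) * h t) * indicator {0<..<1} t +
       ennreal ((1 - t) ^ p) * h t * indicator {0<..<1} t \<partial>lborel)"
    unfolding outer_def
  proof (rule nn_integral_cong)
    fix t :: real
    show "ennreal ((1 - t) ^ p) * (ennreal (form False t) * h t) * indicator {0<..<1} t =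
      ennreal ((1 - t) ^ Suc p) * (ennreal (form False t) * h t) * indicator {0<..<1} t +
       ennreal ((1 - t) ^ p) * h t * indicator {0<..<1} t"
    proof (cases "t \<in> {0<..<1}")
      case True
      then have "ennreal ((1 - t) ^ p) * ennreal (form False t) =
          ennreal ((1 - t) ^ Suc p) * ennreal (form False t) + ennreal ((1 - t) ^ p)"
        by (simp add: ennreal_mult[symmetric] ennreal_plus[symmetric] form_def field_simps
            del: ennreal_plus)
      then have "ennreal ((1 - t) ^ p) * ennreal (form False t) * h t =
          (ennreal ((1 - t) ^ Suc p) * ennreal (form False t) + ennreal ((1 - t) ^ p)) * h t"
        by simp
      then show ?thesis using True by (simp add: mult.assoc distrib_right)
    qed auto
  qed
  also have "\<dots> = outer (Suc p) (\<lambda>t. ennreal (form False t) * h t) + outer p h"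
    unfolding outer_def by (rule nn_integral_add) measurable
  finally show ?thesis .
qed

text \<open>The form 1/r lowers the power by one and integration restores it. The summand 0 gives
  the shape needed for \<open>foldr_iter_op_linear\<close>.\<close>

lemma iter_op_False_unit_mon:
  "iter_op False (unit_mon (Suc q)) = (\<lambda>t. 0 + ennreal (1 / Suc q) * unit_mon (Suc q) t)"
proof
  fix s :: real
  show "iter_op False (unit_mon (Suc q)) s = 0 + ennreal (1 / Suc q) * unit_mon (Suc q) s"
  proof (cases "s \<in> {0<..<1}")
    case True
    have "(\<integral>\<^sup>+r. ennreal (form False r) * unit_mon (Suc q) r * indicator {0<..<s} r \<partial>lborel) =
        (\<integral>\<^sup>+r. ennreal (r ^ q) * indicator {0<..<s} r \<partial>lborel)"
      using True by (intro nn_integral_cong)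
        (auto simp: unit_mon_def indicator_def form_def ennreal_mult[symmetric])
    also have "\<dots> = ennreal (1 / Suc q) * ennreal (s ^ Suc q)"
      using True by (subst nn_integral_Ioo_power) (auto simp: ennreal_mult[symmetric])
    finally show ?thesis using True by (simp add: iter_op_def unit_mon_def)
  qed (auto simp: iter_op_def unit_mon_def)
qed

lemma form_True_unit_mon:
  "ennreal (form True t) * unit_mon q t = ennreal (form True t) * unit_mon (Suc q) t + unit_mon q t"
proof (cases "t \<in> {0<..<1}")
  case True
  then show ?thesis
    by (simp add: unit_mon_def ennreal_mult[symmetric] ennreal_plus[symmetric] form_def field_simps
            del: ennreal_plus)
qed (auto simp: unit_mon_def)

lemma iter_op_True_unit_mon:
  "iter_op True (unit_mon q) =
    (\<lambda>t. iter_op True (unit_mon (Suc q)) t + ennreal (1 / Suc q) * unit_mon (Suc q) t)"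
proof
  fix s :: real
  show "iter_op True (unit_mon q) s =
    iter_op True (unit_mon (Suc q)) s + ennreal (1 / Suc q) * unit_mon (Suc q) s"
  proof (cases "s \<in> {0<..<1}")
    case True
    have "(\<integral>\<^sup>+r. ennreal (form True r) * unit_mon q r * indicator {0<..<s} r \<partial>lborel) =
        (\<integral>\<^sup>+r. ennreal (form True r) * unit_mon (Suc q) r * indicator {0<..<s} r \<partial>lborel) +
        (\<integral>\<^sup>+r. unit_mon q r * indicator {0<..<s} r \<partial>lborel)"
      unfolding form_True_unit_mon[of _ q] distrib_right by (rule nn_integral_add) measurable
    also have "(\<integral>\<^sup>+r. unit_mon q r * indicator {0<..<s} r \<partial>lborel) =
        (\<integral>\<^sup>+r. ennreal (r ^ q) * indicator {0<..<s} r \<partial>lborel)"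
      using True by (intro nn_integral_cong) (auto simp: unit_mon_def indicator_def)
    also have "\<dots> = ennreal (1 / Suc q) * ennreal (s ^ Suc q)"
      using True by (subst nn_integral_Ioo_power) (auto simp: ennreal_mult[symmetric])
    finally show ?thesis using True by (simp add: iter_op_def unit_mon_def)
  qed (auto simp: iter_op_def unit_mon_def)
qed

text \<open>This is the Beta integral with parameters \<open>q + 1\<close> and
  \<open>p + 1\<close>.\<close>

lemma outer_unit_mon:
  "outer p (unit_mon q) = ennreal (fact p * fact q / fact (p + q + 1))"
proof -
  have "((\<lambda>t. t powr (real (Suc q) - 1) * (1 - t) powr (real (Suc p) - 1)) has_integral
      Beta (real (Suc q)) (real (Suc p))) {0..1}"
    by (rule has_integral_Beta_real) auto
  then have "((\<lambda>t. t powr (real (Suc q) - 1) * (1 - t) powr (real (Suc p) - 1)) has_integral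
      Beta (real (Suc q)) (real (Suc p))) {0<..<1}"
    by (simp add: has_integral_Icc_iff_Ioo)
  then have "((\<lambda>t. t ^ q * (1 - t) ^ p) has_integral Beta (real (Suc q)) (real (Suc p))) {0<..<1}"
    by (rule has_integral_eq[rotated]) (auto simp: powr_realpow)
  then have "(\<integral>\<^sup>+t. ennreal (indicator {0<..<1} t * (t ^ q * (1 - t) ^ p)) \<partial>lborel) =
      ennreal (Beta (real (Suc q)) (real (Suc p)))"
    by (intro nn_integral_has_integral_lebesgue) auto
  moreover have "Beta (real (Suc q)) (real (Suc p)) = fact p * fact q / fact (p + q + 1)"
    using Gamma_fact[of q, where 'a = real] Gamma_fact[of p, where 'a = real]
      Gamma_fact[of "p + q + 1", where 'a = real]
    by (simp add: Beta_def add_ac mult_ac)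
  moreover have "outer p (unit_mon q) =
      (\<integral>\<^sup>+t. ennreal (indicator {0<..<1} t * (t ^ q * (1 - t) ^ p)) \<partial>lborel)"
    unfolding outer_def unit_mon_def
    by (intro nn_integral_cong) (auto simp: indicator_def ennreal_mult mult_ac)
  ultimately show ?thesis by simp
qed

text \<open>No integral is attached to the empty word; the inverse binomial coefficient is the value for
  which all four one-letter recursions below remain true at the empty word.\<close>

fun zeta_nn :: "nat \<Rightarrow> nat \<Rightarrow> word \<Rightarrow> ennreal" where
  "zeta_nn p q [] = ennreal (1 / real ((p + q) choose p))"
| "zeta_nn p q (\<eta> # u) = outer p (\<lambda>t. ennreal (form \<eta> t) * foldr iter_op u (unit_mon q) t)"

text \<open>The second factor is the value assigned to the empty word with exponents
  \<open>(Suc p, q)\<close>; this lets \<open>outer_foldr\<close> include the empty word.\<close>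

lemma fact_quotient_left:
  "fact p * fact q / fact (p + q + 1) = 1 / real (Suc p) * (1 / real ((Suc p + q) choose Suc p))"
proof -
  have "real ((Suc p + q) choose Suc p) = fact (p + q + 1) / (real (Suc p) * fact p * fact q)"
    using binomial_fact[of "Suc p" "Suc p + q", where 'a = real] fact_Suc[of p, where 'a = real]
    by (simp del: fact_Suc)
  then show ?thesis by simp
qed

lemma fact_quotient_right:
  "fact p * fact q / fact (p + q + 1) = 1 / real (Suc q) * (1 / real ((p + Suc q) choose p))"
  using fact_quotient_left[of q p] binomial_symmetric[of p "p + Suc q"] by (simp add: add_ac mult_ac)

lemma outer_foldr:
  "outer p (foldr iter_op u (unit_mon q)) = ennreal (1 / Suc p) * zeta_nn (Suc p) q u"
proof (cases u)
  case Nil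
  then show ?thesis
    unfolding Nil by (simp add: outer_unit_mon fact_quotient_left[simplified] ennreal_mult[symmetric])
next
  case (Cons \<eta> v)
  then show ?thesis by (simp add: outer_iter_op)
qed

text \<open>One factor \<open>1 - t\<close> cancels the form of the letter 1, and
  \<open>outer_foldr\<close> integrates out the first variable.\<close>

lemma zeta_nn_True_Cons:
  "zeta_nn (Suc p) q (True # u) = ennreal (1 / Suc p) * zeta_nn (Suc p) q u"
  by (simp only: zeta_nn.simps outer_form_True outer_foldr)

lemma zeta_nn_False_Cons:
  "zeta_nn p q (False # u) = zeta_nn (Suc p) q (False # u) + ennreal (1 / Suc p) * zeta_nn (Suc p) q u"
  by (simp only: zeta_nn.simps outer_foldr[symmetric]) (rule outer_form_False, measurable)

lemma outer_form_linear:
  assumes [measurable]: "f \<in> borel_measurable borel" "g \<in> borel_measurable borel"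
  shows "outer p (\<lambda>t. ennreal (form \<eta> t) * (f t + c * g t)) =
    outer p (\<lambda>t. ennreal (form \<eta> t) * f t) + c * outer p (\<lambda>t. ennreal (form \<eta> t) * g t)"
  by (subst outer_linear[symmetric]) (auto simp: distrib_left mult_ac)

lemma outer_unit_mon_right:
  "outer p (unit_mon q) = ennreal (1 / Suc q) * zeta_nn p (Suc q) []"
  by (simp add: outer_unit_mon fact_quotient_right[simplified] ennreal_mult[symmetric])

lemma foldr_zero: "foldr iter_op u (\<lambda>t. 0) = (\<lambda>t. 0)"
  by (induction u) (auto simp: iter_op_def)

lemma zeta_nn_snoc_False:
  "zeta_nn p (Suc q) (u @ [False]) = ennreal (1 / Suc q) * zeta_nn p (Suc q) u"
proof (cases u)
  case Nil
  \<comment> \<open>In a one-letter word the innermost variable is also the outermost, so the form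
    is cancelled under \<open>outer\<close> itself instead of by \<open>iter_op\<close>.\<close>
  have "outer p (\<lambda>t. ennreal (form False t) * unit_mon (Suc q) t) = outer p (unit_mon q)"
    by (rule outer_cong) (auto simp: unit_mon_def form_def ennreal_mult[symmetric])
  then show ?thesis using Nil outer_unit_mon_right[of p q] by simp
next
  case (Cons \<eta> v)
  have "foldr iter_op (v @ [False]) (unit_mon (Suc q)) =
      (\<lambda>t. 0 + ennreal (1 / Suc q) * foldr iter_op v (unit_mon (Suc q)) t)"
    unfolding foldr_append foldr.simps o_apply id_apply iter_op_False_unit_mon
    by (subst foldr_iter_op_linear) (auto simp: foldr_zero)
  then show ?thesis
    unfolding Cons append_Cons zeta_nn.simps
    by (simp only:) (subst outer_form_linear, auto simp: outer_def)
qed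

lemma zeta_nn_snoc_True:
  "zeta_nn p q (u @ [True]) =
    zeta_nn p (Suc q) (u @ [True]) + ennreal (1 / Suc q) * zeta_nn p (Suc q) u"
proof (cases u)
  case Nil
  have "outer p (\<lambda>t. ennreal (form True t) * unit_mon (Suc q) t + 1 * unit_mon q t) =
      outer p (\<lambda>t. ennreal (form True t) * unit_mon (Suc q) t) + 1 * outer p (unit_mon q)"
    by (rule outer_linear) auto
  then show ?thesis using Nil outer_unit_mon_right[of p q] by (simp add: form_True_unit_mon[of _ q])
next
  case (Cons \<eta> v)
  have "foldr iter_op (v @ [True]) (unit_mon q) =
      (\<lambda>t. foldr iter_op (v @ [True]) (unit_mon (Suc q)) t +
         ennreal (1 / Suc q) * foldr iter_op v (unit_mon (Suc q)) t)"
    unfolding foldr_append foldr.simps o_apply id_apply iter_op_True_unit_mon[of q]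
    by (subst foldr_iter_op_linear) (auto intro: iter_op_measurable)
  then show ?thesis
    unfolding Cons append_Cons zeta_nn.simps
    by (simp only:) (subst outer_form_linear, auto intro!: foldr_iter_op_measurable)
qed

text \<open>Raising the exponent multiplies the integrand by the last variable, which is at most
  \<open>t\<close>.\<close>

lemma foldr_iter_op_unit_mon_Suc_le:
  "foldr iter_op u (unit_mon (Suc q)) t \<le> ennreal t * foldr iter_op u (unit_mon q) t"
proof (induction u arbitrary: t)
  case Nil
  then show ?case by (auto simp: unit_mon_def indicator_def ennreal_mult)
next
  case (Cons \<eta> u)
  let ?g = "foldr iter_op u (unit_mon q)"
  have "(\<integral>\<^sup>+r. ennreal (form \<eta> r) * foldr iter_op u (unit_mon (Suc q)) r * indicator {0<..<t} r \<partial>lborel) \<le>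
      (\<integral>\<^sup>+r. ennreal t * (ennreal (form \<eta> r) * ?g r * indicator {0<..<t} r) \<partial>lborel)"
  proof (rule nn_integral_mono)
    fix r :: real
    have "foldr iter_op u (unit_mon (Suc q)) r \<le> ennreal t * ?g r" if "0 < r" "r < t"
    proof -
      have "ennreal r * ?g r \<le> ennreal t * ?g r" using that by (intro mult_right_mono ennreal_leI) auto
      with Cons.IH[of r] show ?thesis by (rule order_trans)
    qed
    then have "ennreal (form \<eta> r) * foldr iter_op u (unit_mon (Suc q)) r
        \<le> ennreal (form \<eta> r) * (ennreal t * ?g r)" if "0 < r" "r < t"
      using that by (intro mult_left_mono) auto
    then show "ennreal (form \<eta> r) * foldr iter_op u (unit_mon (Suc q)) r * indicator {0<..<t} r \<le>
        ennreal t * (ennreal (form \<eta> r) * ?g r * indicator {0<..<t} r)"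
      by (auto simp: indicator_def mult_ac)
  qed
  also have "\<dots> = ennreal t * (\<integral>\<^sup>+r. ennreal (form \<eta> r) * ?g r * indicator {0<..<t} r \<partial>lborel)"
    by (rule nn_integral_cmult) measurable
  finally show ?case
    by (cases "t \<in> {0<..<1}") (simp_all add: iter_op_def[of \<eta>])
qed

text \<open>The factor \<open>t\<close> gained from the last variable absorbs the leading form 1/t,
  and \<open>outer_foldr\<close> integrates out the first variable.\<close>

lemma zeta_nn_False_le:
  "zeta_nn p (Suc q) (False # u) \<le> ennreal (1 / Suc p) * zeta_nn (Suc p) q u"
  unfolding outer_foldr[symmetric] zeta_nn.simps outer_def
proof (rule nn_integral_mono)
  fix t :: real
  let ?f = "foldr iter_op u (unit_mon (Suc q)) t" and ?g = "foldr iter_op u (unit_mon q) t"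
  show "ennreal ((1 - t) ^ p) * (ennreal (form False t) * ?f) * indicator {0<..<1} t
      \<le> ennreal ((1 - t) ^ p) * ?g * indicator {0<..<1} t"
  proof (cases "t \<in> {0<..<1}")
    case True
    have "ennreal (form False t) * ?f \<le> ennreal (form False t) * (ennreal t * ?g)"
      by (intro mult_left_mono foldr_iter_op_unit_mon_Suc_le) auto
    also have "\<dots> = ?g"
      using True by (simp add: mult.assoc[symmetric] ennreal_mult[symmetric] form_def)
    finally show ?thesis by (intro mult_left_mono mult_right_mono) auto
  qed auto
qed

text \<open>For a word ending with 1 one may increase \<open>q\<close> by \<open>zeta_nn_snoc_True\<close>, and the additional factor
  \<open>t\<close> then cancels a leading \<open>1/t\<close>.\<close>

lemma zeta_nn_finite: "zeta_nn (Suc p) (Suc q) u < top"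
proof (induction "length u" arbitrary: u p q rule: less_induct)
  case less
  show ?case
  proof (cases u rule: rev_cases)
    case Nil
    then show ?thesis by simp
  next
    case (snoc v \<eta>)
    have v: "zeta_nn (Suc p) (Suc q) v < top" for p q using less snoc by simp
    show ?thesis
    proof (cases \<eta>)
      case False
      then show ?thesis using v snoc by (simp add: zeta_nn_snoc_False ennreal_mult_less_top)
    next
      case True
      \<comment> \<open>The exponent is \<open>q + 2\<close> because \<open>zeta_nn_False_le\<close>
        lowers it by one, while the induction hypothesis asks for positive exponents.\<close>
      have "zeta_nn (Suc p) (Suc (Suc q)) u < top"
      proof (cases u)
        case (Cons \<theta> x)
        have x: "zeta_nn (Suc p) (Suc q) x < top" for p q using less Cons by simp
        show ?thesis
        proof (cases \<theta>)
          case True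
          then show ?thesis using x Cons by (simp only: zeta_nn_True_Cons ennreal_mult_less_top) auto
        next
          case False
          have "ennreal (1 / Suc (Suc p)) * zeta_nn (Suc (Suc p)) (Suc q) x < top"
            using x by (auto simp: ennreal_mult_less_top)
          then show ?thesis using zeta_nn_False_le[of "Suc p" "Suc q" x] Cons False by auto
        qed
      qed simp
      then show ?thesis
        using True snoc v zeta_nn_snoc_True[of "Suc p" "Suc q" v] by (auto simp: ennreal_mult_less_top)
    qed
  qed
qed

definition zeta_ext :: "nat \<Rightarrow> nat \<Rightarrow> word \<Rightarrow> real" where
  "zeta_ext p q u = enn2real (zeta_nn p q u)"

lemma zeta_ext_Nil: "zeta_ext p q [] = inverse (real ((p + q) choose p))"
  by (simp add: zeta_ext_def inverse_eq_divide)

lemma zeta_ext_True_Cons: "zeta_ext (Suc p) q (True # u) = zeta_ext (Suc p) q u / Suc p"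
  unfolding zeta_ext_def zeta_nn_True_Cons enn2real_mult by simp

lemma zeta_ext_snoc_False: "zeta_ext p (Suc q) (u @ [False]) = zeta_ext p (Suc q) u / Suc q"
  unfolding zeta_ext_def zeta_nn_snoc_False enn2real_mult by simp

text \<open>The leading 0 is expanded by \<open>zeta_nn_False_Cons\<close>, then the trailing 1 in
  both resulting words by \<open>zeta_nn_snoc_True\<close>. Since \<open>enn2real\<close> is
  additive only on finite values, \<open>zeta_nn_finite\<close> enters here; the exponents on the
  right are positive.\<close>

lemma zeta_ext_False_True:
  "zeta_ext p q (False # v @ [True]) =
    zeta_ext (Suc p) (Suc q) (False # v @ [True]) + zeta_ext (Suc p) (Suc q) (v @ [True]) / Suc p +
    zeta_ext (Suc p) (Suc q) (False # v) / Suc q + zeta_ext (Suc p) (Suc q) v / (real (Suc p) * real (Suc q))"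
proof -
  let ?Z = "zeta_nn (Suc p) (Suc q)" and ?a = "ennreal (1 / Suc p)" and ?b = "ennreal (1 / Suc q)"
  have "zeta_nn p q (False # v @ [True]) =
      (?Z (False # v @ [True]) + ?b * ?Z (False # v)) + ?a * (?Z (v @ [True]) + ?b * ?Z v)"
    using zeta_nn_snoc_True[of "Suc p" q "False # v"] zeta_nn_snoc_True[of "Suc p" q v]
      zeta_nn_False_Cons[of p q "v @ [True]"] by (simp only: append_Cons)
  then have "zeta_ext p q (False # v @ [True]) =
      (enn2real (?Z (False # v @ [True])) + enn2real (?b * ?Z (False # v))) +
      enn2real ?a * (enn2real (?Z (v @ [True])) + enn2real (?b * ?Z v))"
    unfolding zeta_ext_def
    using zeta_nn_finite[of p q] by (simp only:)
      (subst enn2real_plus enn2real_mult, auto simp: ennreal_mult_less_top enn2real_plus enn2real_mult simp del: zeta_nn.simps)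
  then show ?thesis
    by (simp add: zeta_ext_def enn2real_mult distrib_left del: zeta_nn.simps)
qed

section \<open>The integral over the simplex as an iterated integral\<close>

lemma open_simplex_bounds:
  assumes "t \<in> open_simplex l" "i < l"
  shows "0 < t i" "t i < 1"
proof -
  have dec: "t (Suc j) < t j" if "Suc j < l" for j using assms that by (auto simp: open_simplex_def)
  have "t i \<le> t 0" using assms(2)
  proof (induction i)
    case (Suc i)
    then show ?case using dec[of i] by simp
  qed simp
  then show "t i < 1" using assms by (auto simp: open_simplex_def)
  have "t (i + d) \<le> t i" if "i + d < l" for d using that
  proof (induction d)
    case (Suc d)
    then show ?case using dec[of "i + d"] by simp
  qed simp
  from this[of "l - 1 - i"] assms show "0 < t i" by (auto simp: open_simplex_def)
qed

lemma open_simplex_measurable: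
  assumes "l > 0"
  shows "(indicator (open_simplex l) :: _ \<Rightarrow> 'a :: {zero_neq_one, topological_space})
    \<in> borel_measurable (\<Pi>\<^sub>M i\<in>{..<l}. (lborel :: real measure))"
proof -
  let ?M = "\<Pi>\<^sub>M i\<in>{..<l}. (lborel :: real measure)"
  have c: "(\<lambda>t. t i) \<in> borel_measurable ?M" if "i < l" for i
    using that measurable_component_singleton[of i "{..<l}" "\<lambda>_. lborel :: real measure"] by simp
  have "Measurable.pred ?M (\<lambda>t. 1 > t 0 \<and> (\<forall>i\<in>{..<l - 1}. t i > t (Suc i)) \<and> t (l - 1) > 0)"
    using assms
    by (intro pred_intros_logic pred_intros_finite borel_measurable_pred_less c borel_measurable_const) auto
  moreover have "(\<lambda>t :: nat \<Rightarrow> real. 1 > t 0 \<and> (\<forall>i\<in>{..<l - 1}. t i > t (Suc i)) \<and> t (l - 1) > 0)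
     = (\<lambda>t. t \<in> open_simplex l)"
    by (auto simp: open_simplex_def fun_eq_iff less_diff_conv)
  ultimately have [measurable]: "Measurable.pred ?M (\<lambda>t. t \<in> open_simplex l)" by simp
  have "(indicator (open_simplex l) :: _ \<Rightarrow> 'a) = (\<lambda>t. if t \<in> open_simplex l then 1 else 0)"
    by (auto simp: indicator_def fun_eq_iff)
  then show ?thesis by simp
qed

text \<open>The power of the last variable is replaced by an arbitrary \<open>g\<close>, into which
  the integral over a further variable can be absorbed.\<close>

definition simplex_int :: "nat \<Rightarrow> word \<Rightarrow> (real \<Rightarrow> ennreal) \<Rightarrow> ennreal" where
  "simplex_int p u g = (\<integral>\<^sup>+t. ennreal ((1 - t 0) ^ p) * (\<Prod>i<length u. ennreal (form (u ! i) (t i))) *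
     g (t (length u - 1)) * indicator (open_simplex (length u)) t \<partial>(\<Pi>\<^sub>M i\<in>{..<length u}. lborel))"

lemma component_measurable:
  "i < l \<Longrightarrow> (\<lambda>t. t i) \<in> borel_measurable (\<Pi>\<^sub>M i\<in>{..<l}. (lborel :: real measure))"
  using measurable_component_singleton[of i "{..<l}" "\<lambda>_. lborel :: real measure"] by simp

lemma simplex_integrand_measurable:
  assumes g: "g \<in> borel_measurable borel" and u: "u \<noteq> []"
  shows "(\<lambda>t. ennreal ((1 - t 0) ^ p) * (\<Prod>i<length u. ennreal (form (u ! i) (t i))) *
     g (t (length u - 1)) * indicator (open_simplex (length u)) t)
     \<in> borel_measurable (\<Pi>\<^sub>M i\<in>{..<length u}. lborel)"
proof -
  have l: "0 < length u" "length u - 1 < length u" using u by auto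
  have 1: "(\<lambda>t. g (t (length u - 1))) \<in> borel_measurable (\<Pi>\<^sub>M i\<in>{..<length u}. lborel)"
    by (rule measurable_compose[OF component_measurable[OF l(2)] g])
  have 2: "(\<lambda>t. ennreal (form (u ! i) (t i))) \<in> borel_measurable (\<Pi>\<^sub>M i\<in>{..<length u}. lborel)"
    if "i \<in> {..<length u}" for i
    by (rule measurable_compose[OF component_measurable]) (use that in auto)
  have 3: "(\<lambda>t. ennreal ((1 - t 0) ^ p)) \<in> borel_measurable (\<Pi>\<^sub>M i\<in>{..<length u}. lborel)"
    by (rule measurable_compose[OF component_measurable[OF l(1)]]) measurable
  show ?thesis
    by (intro borel_measurable_times_ennreal borel_measurable_prod_ennreal 1 2 3
        open_simplex_measurable l)
qed

text \<open>Fubini with the last coordinate integrated first: for fixed earlier ones it ranges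
  between 0 and its predecessor, as in \<open>iter_op\<close>.\<close>

lemma simplex_int_snoc:
  assumes [measurable]: "g \<in> borel_measurable borel" and u: "u \<noteq> []"
  shows "simplex_int p (u @ [\<eta>]) g = simplex_int p u (iter_op \<eta> g)"
proof -
  interpret product_sigma_finite "\<lambda>_ :: nat. lborel :: real measure" ..
  define l where "l = length u"
  have l: "l > 0" using u by (simp add: l_def)
  let ?F = "\<lambda>t. ennreal ((1 - t 0) ^ p) * (\<Prod>i<length (u @ [\<eta>]). ennreal (form ((u @ [\<eta>]) ! i) (t i))) *
     g (t (length (u @ [\<eta>]) - 1)) * indicator (open_simplex (length (u @ [\<eta>]))) t"
  let ?G = "\<lambda>x. ennreal ((1 - x 0) ^ p) * (\<Prod>i<l. ennreal (form (u ! i) (x i)))"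
  have ins: "{..<length (u @ [\<eta>])} = insert l {..<l}" by (auto simp: l_def)
  have "simplex_int p (u @ [\<eta>]) g = (\<integral>\<^sup>+x. \<integral>\<^sup>+y. ?F (x(l := y)) \<partial>lborel \<partial>(\<Pi>\<^sub>M i\<in>{..<l}. lborel))"
    unfolding simplex_int_def using simplex_integrand_measurable[OF assms(1), of "u @ [\<eta>]" p]
    unfolding ins by (intro product_nn_integral_insert) auto
  also have "\<dots> = (\<integral>\<^sup>+x. ?G x * iter_op \<eta> g (x (l - 1)) * indicator (open_simplex l) x
      \<partial>(\<Pi>\<^sub>M i\<in>{..<l}. lborel))"
  proof (rule nn_integral_cong)
    fix x :: "nat \<Rightarrow> real"
    have ind: "x(l := y) \<in> open_simplex (Suc l) \<longleftrightarrow> x \<in> open_simplex l \<and> 0 < y \<and> y < x (l - 1)" for y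
    proof
      assume A: "x(l := y) \<in> open_simplex (Suc l)"
      have "x i > x (Suc i)" if "Suc i < l" for i
        using A that by (auto simp: open_simplex_def dest: spec[of _ i])
      moreover have "0 < y" "y < x (l - 1)" "x 0 < 1"
        using A l by (auto simp: open_simplex_def dest: spec[of _ "l - 1"])
      ultimately show "x \<in> open_simplex l \<and> 0 < y \<and> y < x (l - 1)"
        by (auto simp: open_simplex_def)
    next
      assume A: "x \<in> open_simplex l \<and> 0 < y \<and> y < x (l - 1)"
      have "(x(l := y)) (Suc i) < (x(l := y)) i" if "Suc i < Suc l" for i
        using A that by (cases "Suc i = l") (auto simp: open_simplex_def)
      then show "x(l := y) \<in> open_simplex (Suc l)" using A l by (auto simp: open_simplex_def)
    qed
    have F: "?F (x(l := y)) = ?G x * indicator (open_simplex l) x *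
        (ennreal (form \<eta> y) * g y * indicator {0<..<x (l - 1)} y)" for y
    proof -
      have "(\<Prod>i<length (u @ [\<eta>]). ennreal (form ((u @ [\<eta>]) ! i) ((x(l := y)) i))) =
          (\<Prod>i<l. ennreal (form (u ! i) (x i))) * ennreal (form \<eta> y)"
        by (simp add: l_def nth_append)
      moreover have "indicator (open_simplex (length (u @ [\<eta>]))) (x(l := y)) =
          (indicator (open_simplex l) x * indicator {0<..<x (l - 1)} y :: ennreal)"
        using ind by (auto simp: indicator_def l_def)
      ultimately show ?thesis using l by (simp add: l_def mult_ac)
    qed
    have "(\<integral>\<^sup>+y. ?F (x(l := y)) \<partial>lborel) = ?G x * indicator (open_simplex l) x *
        (\<integral>\<^sup>+y. ennreal (form \<eta> y) * g y * indicator {0<..<x (l - 1)} y \<partial>lborel)"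
      unfolding F by (rule nn_integral_cmult) measurable
    \<comment> \<open>On the simplex the preceding coordinate lies between 0 and 1, so the extra
      indicator in \<open>iter_op\<close> equals 1.\<close>
    also have "\<dots> = ?G x * iter_op \<eta> g (x (l - 1)) * indicator (open_simplex l) x"
      using open_simplex_bounds[of x l "l - 1"] l by (auto simp: iter_op_def indicator_def)
    finally show "(\<integral>\<^sup>+y. ?F (x(l := y)) \<partial>lborel) =
        ?G x * iter_op \<eta> g (x (l - 1)) * indicator (open_simplex l) x" .
  qed
  finally show ?thesis by (simp add: simplex_int_def l_def)
qed

text \<open>Letters are stripped from the right and absorbed into \<open>g\<close>, which therefore
  varies in the induction; the first letter stays under \<open>outer\<close>.\<close>

lemma simplex_int_Cons:
  assumes "g \<in> borel_measurable borel"
  shows "simplex_int p (\<eta> # u) g = outer p (\<lambda>t. ennreal (form \<eta> t) * foldr iter_op u g t)"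
  using assms
proof (induction u arbitrary: g rule: rev_induct)
  case Nil
  note [measurable] = Nil
  interpret product_sigma_finite "\<lambda>_ :: nat. lborel :: real measure" ..
  have dom: "{..<length [\<eta>]} = {0}" by auto
  have ind: "indicator (open_simplex (Suc 0)) t = (indicator {0<..<1} (t 0) :: ennreal)" for t
    by (auto simp: open_simplex_def indicator_def)
  have "simplex_int p [\<eta>] g = (\<integral>\<^sup>+t. (\<lambda>t. ennreal ((1 - t) ^ p) * (ennreal (form \<eta> t) * g t) *
      indicator {0<..<1} t) (t 0) \<partial>(\<Pi>\<^sub>M i\<in>{0 :: nat}. lborel))"
    unfolding simplex_int_def dom by (intro nn_integral_cong) (simp add: ind mult.assoc)
  also have "\<dots> = outer p (\<lambda>t. ennreal (form \<eta> t) * g t)"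
    unfolding outer_def by (rule product_nn_integral_singleton) measurable
  finally show ?case by simp
next
  case (snoc \<theta> u)
  then show ?case using simplex_int_snoc[of g "\<eta> # u" p \<theta>] iter_op_measurable[of g \<theta>] by simp
qed

text \<open>The integrand is nonnegative on the simplex. A divergent integral is covered too: the
  Lebesgue integral is then 0 by convention, as is \<open>enn2real top\<close>.\<close>

lemma zeta_int_eq_zeta_ext:
  assumes u: "u \<noteq> []"
  shows "zeta_int u p q = zeta_ext p q u"
proof -
  let ?M = "\<Pi>\<^sub>M i\<in>{..<length u}. (lborel :: real measure)"
  let ?f = "\<lambda>t. indicator (open_simplex (length u)) t *\<^sub>R
    ((1 - t 0) ^ p * (\<Prod>i<length u. form (u ! i) (t i)) * t (length u - 1) ^ q)"
  have l: "length u > 0" "length u - 1 < length u" using u by auto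
  have 1: "(\<lambda>t. form (u ! i) (t i)) \<in> borel_measurable ?M" if "i \<in> {..<length u}" for i
    by (rule measurable_compose[OF component_measurable form_measurable]) (use that in auto)
  have 2: "(\<lambda>t. (1 - t 0) ^ p) \<in> borel_measurable ?M"
    by (rule measurable_compose[OF component_measurable[OF l(1)]]) measurable
  have 3: "(\<lambda>t. t (length u - 1) ^ q) \<in> borel_measurable ?M"
    by (rule measurable_compose[OF component_measurable[OF l(2)]]) measurable
  have f: "?f \<in> borel_measurable ?M"
    by (intro borel_measurable_scaleR borel_measurable_times borel_measurable_prod 1 2 3
        open_simplex_measurable l)
  have b: "0 < t i \<and> t i < 1" if "t \<in> open_simplex (length u)" "i < length u" for t i
    using open_simplex_bounds that by blast
  have nonneg: "0 \<le> (\<Prod>i<length u. form (u ! i) (t i))" if "t \<in> open_simplex (length u)" for t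
    using b[OF that] form_pos by (intro prod_nonneg) (auto intro: less_imp_le)
  have "zeta_int u p q = enn2real (\<integral>\<^sup>+t. ennreal (?f t) \<partial>?M)"
    unfolding zeta_int_def set_lebesgue_integral_def
  proof (rule integral_eq_nn_integral)
    show "AE t in ?M. 0 \<le> ?f t"
    proof (rule AE_I2)
      fix t show "0 \<le> ?f t"
      proof (cases "t \<in> open_simplex (length u)")
        case True
        then have "0 \<le> (1 - t 0) ^ p * (\<Prod>i<length u. form (u ! i) (t i)) * t (length u - 1) ^ q"
          using b[OF True l(1)] b[OF True l(2)] nonneg[OF True]
          by (intro mult_nonneg_nonneg zero_le_power) auto
        then show ?thesis by simp
      qed simp
    qed
  qed (rule f)
  also have "(\<integral>\<^sup>+t. ennreal (?f t) \<partial>?M) = simplex_int p u (unit_mon q)"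
    unfolding simplex_int_def
  proof (rule nn_integral_cong)
    fix t :: "nat \<Rightarrow> real"
    show "ennreal (?f t) = ennreal ((1 - t 0) ^ p) * (\<Prod>i<length u. ennreal (form (u ! i) (t i))) *
       unit_mon q (t (length u - 1)) * indicator (open_simplex (length u)) t"
    proof (cases "t \<in> open_simplex (length u)")
      case True
      have "(\<Prod>i<length u. ennreal (form (u ! i) (t i))) = ennreal (\<Prod>i<length u. form (u ! i) (t i))"
        using b[OF True] form_pos by (intro prod_ennreal) (auto intro: less_imp_le)
      then show ?thesis using True nonneg[OF True] b[OF True l(1)] b[OF True l(2)]
        by (auto simp: unit_mon_def ennreal_mult)
    qed auto
  qed
  also have "\<dots> = zeta_nn p q u"
    using u by (cases u) (auto simp: simplex_int_Cons)
  finally show ?thesis by (simp add: zeta_ext_def)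
qed

section \<open>Summation over factors of the word\<close>

lemma mid_word_Cons:
  "i < j \<Longrightarrow> j \<le> length w \<Longrightarrow> mid_word w (i, j) = w ! i # mid_word w (Suc i, j)"
  unfolding mid_word_def using Cons_nth_drop_Suc[of i w, symmetric]
  by (auto simp: take_Cons' simp flip: diff_Suc_eq_diff_pred)

lemma mid_word_snoc:
  "i \<le> j \<Longrightarrow> j < length w \<Longrightarrow> mid_word w (i, Suc j) = mid_word w (i, j) @ [w ! j]"
  unfolding mid_word_def by (simp add: Suc_diff_le take_Suc_conv_app_nth)

lemma mid_word_self: "mid_word w (i, i) = []"
  by (simp add: mid_word_def)

text \<open>The pair \<open>(i, j)\<close> of \<open>inner_pairs\<close> stands for the pair \<open>(i, Suc j)\<close> of \<open>S_pairs\<close>.\<close>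

definition inner_pairs :: "word \<Rightarrow> (nat \<times> nat) set" where
  "inner_pairs w = {(i, j). i < j \<and> j < length w \<and> \<not> w ! i \<and> w ! j}"

text \<open>With \<open>v = mid_word w (Suc i, j)\<close> these are the words occurring in
  \<open>zeta_ext_False_True\<close>.\<close>

lemma mid_word_inner_pair:
  assumes "(i, j) \<in> inner_pairs w"
  shows "mid_word w (i, Suc j) = False # mid_word w (Suc i, j) @ [True]"
    and "mid_word w (Suc i, Suc j) = mid_word w (Suc i, j) @ [True]"
    and "mid_word w (i, j) = False # mid_word w (Suc i, j)"
  using assms mid_word_Cons[of i "Suc j" w] mid_word_snoc[of "Suc i" j w] mid_word_Cons[of i j w]
  by (auto simp: inner_pairs_def)

lemma S_pairs_eq: "S_pairs w = (\<lambda>(i, j). (i, Suc j)) ` inner_pairs w"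
proof (intro set_eqI iffI)
  fix s assume "s \<in> S_pairs w"
  then obtain i j where s: "s = (i, j)" "i \<le> j" "j \<le> length w"
    "mid_word w (i, j) \<noteq> []" "admissible (mid_word w (i, j))"
    by (auto simp: S_pairs_def)
  then have "i < j" using mid_word_self[of w i] by (cases "i = j") auto
  then obtain j' where j: "j = Suc j'" by (cases j) auto
  have "\<not> w ! i" "w ! j'"
    using s \<open>i < j\<close> mid_word_Cons[of i j w] mid_word_snoc[of i j' w] j
    by (auto simp: admissible_def)
  \<comment> \<open>One letter cannot be both 0 and 1.\<close>
  moreover from this have "i \<noteq> j'" by auto
  ultimately have "(i, j') \<in> inner_pairs w" using s \<open>i < j\<close> j by (auto simp: inner_pairs_def)
  then show "s \<in> (\<lambda>(i, j). (i, Suc j)) ` inner_pairs w" using s j by auto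
next
  fix s assume "s \<in> (\<lambda>(i, j). (i, Suc j)) ` inner_pairs w"
  then obtain i j where s: "s = (i, Suc j)" and ij: "(i, j) \<in> inner_pairs w" by auto
  then show "s \<in> S_pairs w"
    using mid_word_inner_pair(1)[OF ij] by (auto simp: S_pairs_def admissible_def inner_pairs_def)
qed

definition prefix_dual :: "word \<Rightarrow> nat \<Rightarrow> word" where
  "prefix_dual w i = map Not (rev (take i w))"

text \<open>The sum over \<open>S\<close> as a function of \<open>N\<close>, including the value
  \<open>N = 0\<close> from which the induction starts.\<close>

definition pairs_sum :: "word \<Rightarrow> nat \<Rightarrow> nat \<Rightarrow> nat \<Rightarrow> real" where
  "pairs_sum w m n N = (\<Sum>(i, j)\<in>inner_pairs w. zeta_trunc m (m + N) (word_comp (prefix_dual w i)) *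
     zeta_trunc n (n + N) (word_comp (drop (Suc j) w)) *
     zeta_ext (m + N) (n + N) (mid_word w (i, Suc j)))"

lemma prefix_dual_last: "hd w = False \<Longrightarrow> prefix_dual w i = [] \<or> last (prefix_dual w i)"
  unfolding prefix_dual_def by (cases w; cases i) (auto simp: last_map last_rev)

lemma drop_last: "last w = True \<Longrightarrow> drop j w = [] \<or> last (drop j w)"
  by (cases "j < length w") (auto simp: last_drop)

lemma prefix_dual_Suc: "i < length w \<Longrightarrow> prefix_dual w (Suc i) = (\<not> w ! i) # prefix_dual w i"
  by (simp add: prefix_dual_def take_Suc_conv_app_nth)

text \<open>\<open>zeta_ext_False_True\<close> raises both exponents in every summand, and
  \<open>telescoping_step\<close> regroups the resulting four terms; the empty factors yield the
  inverse binomial coefficient.\<close>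

lemma pairs_sum_Suc:
  assumes w: "w \<noteq> []" "admissible w"
  shows "pairs_sum w m n N = pairs_sum w m n (Suc N) +
    inverse (real ((m + n + 2 * Suc N) choose (m + Suc N))) *
      (\<Sum>i = 1..length w - 1. phi m (m + Suc N) (b_comp w (i, i)) * phi n (n + Suc N) (a_comp w (i, i)) *
        lam (m + Suc N) (n + Suc N) (w ! (i - 1)) (w ! i))"
proof -
  have hl: "hd w = False" "last w = True" using w by (auto simp: admissible_def)
  note pd = prefix_dual_last[OF hl(1)] and dl = drop_last[OF hl(2)]
  define p q where "p = m + N" and "q = n + N"
  define J where "J i j = zeta_ext (Suc p) (Suc q) (mid_word w (i, j))" for i j
  define B where "B i = zeta_trunc m (m + N) (word_comp (prefix_dual w i))" for i
  define A where "A j = zeta_trunc n (n + N) (word_comp (drop j w))" for j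
  define \<phi> where "\<phi> i = phi_word m (m + Suc N) (prefix_dual w i)" for i
  define \<psi> where "\<psi> j = phi_word n (n + Suc N) (drop j w)" for j
  define c where "c = inverse (real ((Suc p + Suc q) choose Suc p))"
  have \<phi>S: "\<phi> (Suc i) = (if w ! i then \<phi> i else B i) / real (Suc p)" if "i < length w" for i
  proof -
    \<comment> \<open>The prefix is empty only for \<open>i = 0\<close>, and the first letter of
      \<open>w\<close> is 0, so its complement is 1, as \<open>phi_word_Cons\<close>
      requires.\<close>
    have "prefix_dual w i \<noteq> [] \<or> \<not> w ! i"
      using that hl w by (cases i) (auto simp: prefix_dual_def hd_conv_nth)
    then show ?thesis
      using that phi_word_Cons[OF pd, of i "\<not> w ! i" m N]
      by (simp add: \<phi>_def B_def p_def prefix_dual_Suc)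
  qed
  have \<psi>S: "\<psi> i = (if w ! i then A (Suc i) else \<psi> (Suc i)) / real (Suc q)" if "i < length w" for i
  proof -
    have "drop (Suc i) w \<noteq> [] \<or> w ! i"
      using that hl(2) last_conv_nth[OF w(1)] diff_Suc_1[of i] by (cases "Suc i = length w") auto
    then show ?thesis
      using that phi_word_Cons[OF dl, of "Suc i" "w ! i" n N]
      by (simp add: \<psi>_def A_def q_def Cons_nth_drop_Suc)
  qed
  have "pairs_sum w m n N = (\<Sum>(i, j)\<in>inner_pairs w. B i * A (Suc j) *
      (J i (Suc j) + J (Suc i) (Suc j) / real (Suc p) + J i j / real (Suc q) +
        J (Suc i) j / (real (Suc p) * real (Suc q))))"
    unfolding pairs_sum_def
  proof (intro sum.cong refl, clarify)
    fix i j assume ij: "(i, j) \<in> inner_pairs w"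
    show "zeta_trunc m (m + N) (word_comp (prefix_dual w i)) *
       zeta_trunc n (n + N) (word_comp (drop (Suc j) w)) *
       zeta_ext (m + N) (n + N) (mid_word w (i, Suc j)) = B i * A (Suc j) *
      (J i (Suc j) + J (Suc i) (Suc j) / real (Suc p) + J i j / real (Suc q) +
        J (Suc i) j / (real (Suc p) * real (Suc q)))"
      unfolding J_def A_def B_def mid_word_inner_pair[OF ij] p_def q_def
      by (subst zeta_ext_False_True) (rule refl)
  qed
  also have "\<dots> = (\<Sum>(i, j)\<in>inner_pairs w. (B i + \<phi> i) * (A (Suc j) + \<psi> (Suc j)) * J i (Suc j)) +
      c * (\<Sum>i = 1..length w - 1. \<phi> i * \<psi> i *
        (1 + (if w ! (i - 1) then 0 else real (Suc p) / real (Suc q)) +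
          (if w ! i then real (Suc q) / real (Suc p) else 0)))"
    unfolding inner_pairs_def
  proof (rule telescoping_step)
    show "J i i = c" for i by (simp add: J_def c_def mid_word_self zeta_ext_Nil)
    show "J i j = J (Suc i) j / real (Suc p)" if "w ! i" "i < j" "j \<le> length w" for i j
      using that unfolding J_def by (simp add: mid_word_Cons zeta_ext_True_Cons)
    show "J i (Suc j) = J i j / real (Suc q)" if "\<not> w ! j" "i \<le> j" "j < length w" for i j
      using that unfolding J_def by (simp add: mid_word_snoc zeta_ext_snoc_False)
    show "\<phi> 0 = 0" by (simp add: \<phi>_def phi_word_def prefix_dual_def)
    show "\<psi> (length w) = 0" by (simp add: \<psi>_def phi_word_def)
  qed (simp_all only: \<phi>S \<psi>S of_nat_0_less_iff zero_less_Suc)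
  \<comment> \<open>Adding \<open>\<phi>\<close> to \<open>B\<close> and \<open>\<psi>\<close> to
    \<open>A\<close> raises the upper limits of the truncated sums by one.\<close>
  also have "(\<Sum>(i, j)\<in>inner_pairs w. (B i + \<phi> i) * (A (Suc j) + \<psi> (Suc j)) * J i (Suc j)) =
      pairs_sum w m n (Suc N)"
    unfolding pairs_sum_def zeta_trunc_word_Suc[OF pd] zeta_trunc_word_Suc[OF dl]
    by (simp add: B_def A_def \<phi>_def \<psi>_def J_def p_def q_def)
  also have "c = inverse (real ((m + n + 2 * Suc N) choose (m + Suc N)))"
  proof -
    have "Suc p + Suc q = m + n + 2 * Suc N" "Suc p = m + Suc N" by (simp_all add: p_def q_def)
    then show ?thesis unfolding c_def by (simp only:)
  qed
  also have "(\<Sum>i = 1..length w - 1. \<phi> i * \<psi> i *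
        (1 + (if w ! (i - 1) then 0 else real (Suc p) / real (Suc q)) +
          (if w ! i then real (Suc q) / real (Suc p) else 0))) =
      (\<Sum>i = 1..length w - 1. phi m (m + Suc N) (b_comp w (i, i)) * phi n (n + Suc N) (a_comp w (i, i)) *
        lam (m + Suc N) (n + Suc N) (w ! (i - 1)) (w ! i))"
  proof (rule sum.cong)
    fix i assume i: "i \<in> {1..length w - 1}"
    then have "prefix_dual w i \<noteq> []" "drop i w \<noteq> []" by (auto simp: prefix_dual_def)
    then have "\<phi> i = phi m (m + Suc N) (b_comp w (i, i))" "\<psi> i = phi n (n + Suc N) (a_comp w (i, i))"
      by (simp_all add: \<phi>_def \<psi>_def phi_word_def b_comp_def a_comp_def prefix_dual_def)
    moreover have "Suc p = m + Suc N" "Suc q = n + Suc N" by (simp_all add: p_def q_def)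
    ultimately show "\<phi> i * \<psi> i *
        (1 + (if w ! (i - 1) then 0 else real (Suc p) / real (Suc q)) +
          (if w ! i then real (Suc q) / real (Suc p) else 0)) =
      phi m (m + Suc N) (b_comp w (i, i)) * phi n (n + Suc N) (a_comp w (i, i)) *
        lam (m + Suc N) (n + Suc N) (w ! (i - 1)) (w ! i)"
      unfolding lam_def by (simp only:)
  qed simp
  finally show ?thesis .
qed

text \<open>Over an empty range a truncated sum vanishes unless its word is empty; only the pair
  whose factor is the whole of \<open>w\<close> remains.\<close>

lemma pairs_sum_0:
  assumes w: "w \<noteq> []" "admissible w"
  shows "pairs_sum w m n 0 = zeta_int w m n"
proof -
  have hl: "hd w = False" "last w = True" using w by (auto simp: admissible_def)
  let ?k = "length w"
  have w0: "\<not> w ! 0" "w ! (?k - 1)" using hl w by (auto simp: hd_conv_nth last_conv_nth)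
  then have "?k - 1 \<noteq> 0" by metis
  then have k: "(0, ?k - 1) \<in> inner_pairs w" using w0 by (auto simp: inner_pairs_def)
  have fin: "finite (inner_pairs w)"
    by (rule finite_subset[of _ "{..<?k} \<times> {..<?k}"]) (auto simp: inner_pairs_def)
  have "pairs_sum w m n 0 = (\<Sum>s\<in>inner_pairs w. if s = (0, ?k - 1) then zeta_ext m n w else 0)"
    unfolding pairs_sum_def zeta_trunc_word_empty_range[OF prefix_dual_last[OF hl(1)]]
      zeta_trunc_word_empty_range[OF drop_last[OF hl(2)]]
  proof (rule sum.cong, rule refl, clarify)
    fix i j assume ij: "(i, j) \<in> inner_pairs w"
    then have "prefix_dual w i = [] \<longleftrightarrow> i = 0" "drop (Suc j) w = [] \<longleftrightarrow> j = ?k - 1"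
      using w by (auto simp: prefix_dual_def inner_pairs_def)
    moreover have "mid_word w (0, Suc (?k - 1)) = w" using w by (simp add: mid_word_def)
    ultimately show "(if prefix_dual w i = [] then 1 else 0) * (if drop (Suc j) w = [] then 1 else 0) *
        zeta_ext (m + 0) (n + 0) (mid_word w (i, Suc j)) =
        (if (i, j) = (0, ?k - 1) then zeta_ext m n w else 0)"
      by auto
  qed
  also have "\<dots> = zeta_int w m n" using fin k zeta_int_eq_zeta_ext[OF w(1)] by simp
  finally show ?thesis .
qed

lemma pairs_sum_eq:
  "pairs_sum w m n N = (\<Sum>s\<in>S_pairs w. zeta_trunc m (m + N) (b_comp w s) *
     zeta_trunc n (n + N) (a_comp w s) * zeta_int (mid_word w s) (m + N) (n + N))"
proof -
  have "(\<Sum>s\<in>S_pairs w. zeta_trunc m (m + N) (b_comp w s) *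
     zeta_trunc n (n + N) (a_comp w s) * zeta_int (mid_word w s) (m + N) (n + N)) =
     (\<Sum>(i, j)\<in>inner_pairs w. zeta_trunc m (m + N) (b_comp w (i, Suc j)) *
     zeta_trunc n (n + N) (a_comp w (i, Suc j)) * zeta_int (mid_word w (i, Suc j)) (m + N) (n + N))"
    unfolding S_pairs_eq by (subst sum.reindex) (auto simp: inj_on_def case_prod_unfold)
  also have "\<dots> = pairs_sum w m n N"
    unfolding pairs_sum_def
    by (intro sum.cong refl)
      (auto simp: b_comp_def a_comp_def prefix_dual_def mid_word_inner_pair zeta_int_eq_zeta_ext)
  finally show ?thesis by simp
qed

theorem theorem8:
  fixes w :: word and m n N :: nat
  assumes "w \<noteq> []" and "admissible w" and "N \<ge> 1"
  shows "zeta_int w m n =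
    (\<Sum>s\<in>S_pairs w. zeta_trunc m (m + N) (b_comp w s) * zeta_trunc n (n + N) (a_comp w s) *
        zeta_int (mid_word w s) (m + N) (n + N)) +
    (\<Sum>M = 1..N. inverse (real ((m + n + 2 * M) choose (m + M))) *
      (\<Sum>i = 1..length w - 1. phi m (m + M) (b_comp w (i, i)) * phi n (n + M) (a_comp w (i, i)) *
        lam (m + M) (n + M) (w ! (i - 1)) (w ! i)))"
proof -
  let ?b = "\<lambda>M. inverse (real ((m + n + 2 * M) choose (m + M))) *
      (\<Sum>i = 1..length w - 1. phi m (m + M) (b_comp w (i, i)) * phi n (n + M) (a_comp w (i, i)) *
        lam (m + M) (n + M) (w ! (i - 1)) (w ! i))"
  \<comment> \<open>The one-step identity is iterated; the step from \<open>N\<close> to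
    \<open>Suc N\<close> contributes the term \<open>M = Suc N\<close>.\<close>
  have "pairs_sum w m n 0 = pairs_sum w m n N + (\<Sum>M = 1..N. ?b M)"
  proof (induction N)
    case (Suc N)
    then show ?case using pairs_sum_Suc[OF assms(1,2), of m n N]
      by (simp only: sum.cl_ivl_Suc) simp
  qed simp
  then show ?thesis unfolding pairs_sum_0[OF assms(1,2)] pairs_sum_eq[of w m n N] .
qed

end
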